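(* For any positive integers $r$ and $s$, there is a tight chiral polyhedron of type $\{8r, 32s\}$.
   Context: An (abstract) polyhedron is a partially ordered set whose elements have rank $0$, $1$, $2$ (vertices, edges, faces), incidence meaning comparability, such that every edge is incident to exactly two vertices and two faces, whenever a vertex is incident to a face exactly two edges are incident to both, the incidence graph is connected, and for each vertex or face the subgraph of the incidence graph induced on its neighbours is connected. A flag is a mutually incident (vertex, edge, face) triple; $\Phi^i$ is the flag differing from $\Phi$ exactly in its rank-$i$ element. Type $\{p,q\}$: faces are incident to $p$ edges and vertices to $q$ edges. An automorphism is an incidence-preserving bijection. The polyhedron is chiral if its flags split into two classes with $\Phi,\Phi^i$ always in different classes and the automorphism group transitive on each class but not on all flags. A polyhedron of type $\{p,q\}$ is tight if it has exactly $2pq$ flags. *)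

theory Defs
  imports Complex_Main
begin

record 'a ranked_poset =
  elems :: "'a set"
  le_rel :: "'a rel"
  rk :: "'a \<Rightarrow> nat"

definition verts :: "'a ranked_poset \<Rightarrow> 'a set" where
  "verts P = {x \<in> elems P. rk P x = 0}"

definition edges :: "'a ranked_poset \<Rightarrow> 'a set" where
  "edges P = {x \<in> elems P. rk P x = 1}"

definition faces :: "'a ranked_poset \<Rightarrow> 'a set" where
  "faces P = {x \<in> elems P. rk P x = 2}"

definition incident :: "'a ranked_poset \<Rightarrow> 'a \<Rightarrow> 'a \<Rightarrow> bool" where
  "incident P x y \<longleftrightarrow> (x, y) \<in> le_rel P \<or> (y, x) \<in> le_rel P"

text \<open>Comparability is reflexive, whereas the incidence graph has no loops; hence \<open>y \<noteq> x\<close>.\<close>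

definition neighbours :: "'a ranked_poset \<Rightarrow> 'a \<Rightarrow> 'a set" where
  "neighbours P x = {y \<in> elems P. y \<noteq> x \<and> incident P x y}"

text \<open>The subgraph of the incidence graph induced on \<open>S\<close> is connected (in particular nonempty).\<close>

definition induced_connected :: "'a ranked_poset \<Rightarrow> 'a set \<Rightarrow> bool" where
  "induced_connected P S \<longleftrightarrow> S \<noteq> {} \<and>
     (\<forall>x\<in>S. \<forall>y\<in>S. (x, y) \<in> {(u, v). u \<in> S \<and> v \<in> S \<and> v \<in> neighbours P u}\<^sup>*)"

definition abstract_polyhedron :: "'a ranked_poset \<Rightarrow> bool" where
  "abstract_polyhedron P \<longleftrightarrow>
     partial_order_on (elems P) (le_rel P) \<and>
     (\<forall>x\<in>elems P. rk P x \<in> {0, 1, 2}) \<and>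
     (\<forall>x y. (x, y) \<in> le_rel P \<and> x \<noteq> y \<longrightarrow> rk P x < rk P y) \<and>
     (\<forall>e\<in>edges P. card {v \<in> verts P. incident P v e} = 2 \<and>
                   card {f \<in> faces P. incident P e f} = 2) \<and>
     (\<forall>v\<in>verts P. \<forall>f\<in>faces P. incident P v f \<longrightarrow>
        card {e \<in> edges P. incident P v e \<and> incident P e f} = 2) \<and>
     induced_connected P (elems P) \<and>
     (\<forall>x \<in> verts P \<union> faces P. induced_connected P (neighbours P x))"

definition flags :: "'a ranked_poset \<Rightarrow> ('a \<times> 'a \<times> 'a) set" where
  "flags P = {(v, e, f). v \<in> verts P \<and> e \<in> edges P \<and> f \<in> faces P \<and>
                incident P v e \<and> incident P e f \<and> incident P v f}"

fun flag_elem :: "'a \<times> 'a \<times> 'a \<Rightarrow> nat \<Rightarrow> 'a" where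
  "flag_elem (v, e, f) i = [v, e, f] ! i"

text \<open>\<open>\<Psi> = \<Phi>\<^sup>i\<close>, expressed as a relation; in a polyhedron exactly one such \<open>\<Psi>\<close> exists
  for each flag \<open>\<Phi>\<close> and each \<open>i \<le> 2\<close>.\<close>

definition adjacent_flags :: "'a ranked_poset \<Rightarrow> nat \<Rightarrow> 'a \<times> 'a \<times> 'a \<Rightarrow> 'a \<times> 'a \<times> 'a \<Rightarrow> bool" where
  "adjacent_flags P i \<Phi> \<Psi> \<longleftrightarrow> \<Phi> \<in> flags P \<and> \<Psi> \<in> flags P \<and>
     (\<forall>j\<le>2. flag_elem \<Phi> j \<noteq> flag_elem \<Psi> j \<longleftrightarrow> j = i)"

definition of_type :: "'a ranked_poset \<Rightarrow> nat \<Rightarrow> nat \<Rightarrow> bool" where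
  "of_type P p q \<longleftrightarrow>
     (\<forall>f\<in>faces P. finite {e \<in> edges P. incident P e f} \<and> card {e \<in> edges P. incident P e f} = p) \<and>
     (\<forall>v\<in>verts P. finite {e \<in> edges P. incident P v e} \<and> card {e \<in> edges P. incident P v e} = q)"

text \<open>Automorphisms respect ranks: dualities are not automorphisms. (For a polyhedron, a bijection
  that preserves incidence and maps one flag to a flag preserves all ranks.)\<close>

definition automorphism :: "'a ranked_poset \<Rightarrow> ('a \<Rightarrow> 'a) \<Rightarrow> bool" where
  "automorphism P g \<longleftrightarrow> bij_betw g (elems P) (elems P) \<and>
     (\<forall>x\<in>elems P. rk P (g x) = rk P x) \<and>
     (\<forall>x\<in>elems P. \<forall>y\<in>elems P. incident P (g x) (g y) \<longleftrightarrow> incident P x y)"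

definition flag_image :: "('a \<Rightarrow> 'a) \<Rightarrow> 'a \<times> 'a \<times> 'a \<Rightarrow> 'a \<times> 'a \<times> 'a" where
  "flag_image g = map_prod g (map_prod g g)"

definition transitive_on_flags :: "'a ranked_poset \<Rightarrow> ('a \<times> 'a \<times> 'a) set \<Rightarrow> bool" where
  "transitive_on_flags P C \<longleftrightarrow>
     (\<forall>\<Phi>\<in>C. \<forall>\<Psi>\<in>C. \<exists>g. automorphism P g \<and> flag_image g \<Phi> = \<Psi>)"

definition chiral :: "'a ranked_poset \<Rightarrow> bool" where
  "chiral P \<longleftrightarrow>
     (\<exists>A B. A \<union> B = flags P \<and> A \<inter> B = {} \<and>
        (\<forall>i\<le>2. \<forall>\<Phi> \<Psi>. adjacent_flags P i \<Phi> \<Psi> \<longrightarrow>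
           \<Phi> \<in> A \<and> \<Psi> \<in> B \<or> \<Phi> \<in> B \<and> \<Psi> \<in> A) \<and>
        transitive_on_flags P A \<and> transitive_on_flags P B \<and>
        \<not> transitive_on_flags P (flags P))"

definition tight_of_type :: "'a ranked_poset \<Rightarrow> nat \<Rightarrow> nat \<Rightarrow> bool" where
  "tight_of_type P p q \<longleftrightarrow> of_type P p q \<and> finite (flags P) \<and> card (flags P) = 2 * p * q"

end

theory Submission
  imports Defs "HOL-Library.Countable_Set" "HOL-Number_Theory.Cong"
    "HOL-Algebra.Multiplicative_Group" "HOL-Algebra.Left_Coset"
begin

text \<open>
  A finite group \<open>G = \<langle>a\<rangle>\<langle>b\<rangle>\<close> in which \<open>\<langle>a\<rangle> \<inter> \<langle>b\<rangle>\<close> is trivial and \<open>ab\<close> is an involution is the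
  rotation group of a tight polyhedron: its vertices, edges and faces are the left cosets of \<open>\<langle>b\<rangle>\<close>,
  \<open>\<langle>ab\<rangle>\<close> and \<open>\<langle>a\<rangle>\<close>, and two of them are incident if they intersect. The flags form two \<open>G\<close>-orbits,
  and an automorphism that interchanges them induces an endomorphism of \<open>G\<close> that inverts both \<open>a\<close>
  and \<open>b\<close>. If there is none, the polyhedron is chiral. Replacing \<open>(a, b)\<close> by \<open>(b\<inverse>, a\<inverse>)\<close> gives
  the dual polyhedron.

  For \<open>q = 32 s\<close> and \<open>p = M R\<close> with \<open>M\<close> and \<open>R\<close> coprime and \<open>8 | M | q\<close>, such a group is obtained as
  a Zappa-Szep product of the cyclic groups \<open>\<langle>a\<rangle> = \<int>/M \<times> \<int>/R\<close> and \<open>\<langle>b\<rangle> = \<int>/q\<close>: on \<open>\<int>/R\<close> the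
  generator \<open>b\<close> acts by inversion, and on \<open>\<int>/M\<close> according to \<open>b\<^sup>f a\<^sup>u = a\<^bsup>u + \<delta>\<^esup> b\<^bsup>f + \<delta>\<^esup>\<close>, where
  \<open>\<delta>\<close> is a function of \<open>f\<close> and \<open>u\<close> whose values at \<open>(2, 1)\<close> and \<open>(-2, -1)\<close> are not opposite. As one
  of the \<open>2\<close>-parts of \<open>8 r\<close> and \<open>32 s\<close> divides the other, the type \<open>{8 r, 32 s}\<close> or its dual is of
  this form.
\<close>

declare One_nat_def [simp del]

section \<open>Flags, automorphisms and connectivity\<close>

lemma le_2_iff: "i \<le> (2 :: nat) \<longleftrightarrow> i = 0 \<or> i = 1 \<or> i = 2"
  by auto

lemma incident_commute: "incident P x y \<longleftrightarrow> incident P y x"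
  unfolding incident_def by blast

lemma adjacent_flags_iff:
  "adjacent_flags P i (v, e, f) (v', e', f') \<longleftrightarrow>
    (v, e, f) \<in> flags P \<and> (v', e', f') \<in> flags P \<and>
    (v \<noteq> v' \<longleftrightarrow> i = 0) \<and> (e \<noteq> e' \<longleftrightarrow> i = 1) \<and> (f \<noteq> f' \<longleftrightarrow> i = 2)"
  unfolding adjacent_flags_def le_2_iff by (auto simp: numeral_2_eq_2 One_nat_def)

lemma adjacent_flags_sym: "adjacent_flags P i \<Phi> \<Psi> \<Longrightarrow> adjacent_flags P i \<Psi> \<Phi>"
  unfolding adjacent_flags_def by metis

lemma adjacent_flags_unique:
  assumes "abstract_polyhedron P" "i \<le> 2"
    and "adjacent_flags P i \<Phi> \<Psi>" "adjacent_flags P i \<Phi> \<Psi>'"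
  shows "\<Psi> = \<Psi>'"
proof -
  obtain v e f v1 e1 f1 v2 e2 f2
    where eq: "\<Phi> = (v, e, f)" "\<Psi> = (v1, e1, f1)" "\<Psi>' = (v2, e2, f2)"
    by (metis prod.exhaust)
  have flags: "(v, e, f) \<in> flags P" "(v1, e1, f1) \<in> flags P" "(v2, e2, f2) \<in> flags P"
    using assms(3,4) unfolding eq adjacent_flags_iff by auto
  have other_unique: "y = z"
    if "card S = 2" "x \<in> S" "y \<in> S" "z \<in> S" "y \<noteq> x" "z \<noteq> x" for x y z and S :: "'a set"
    using that by (metis card_2_iff insertE singletonD)
  have card: "card {v \<in> verts P. incident P v e} = 2" "card {f \<in> faces P. incident P e f} = 2"
    "card {e \<in> edges P. incident P v e \<and> incident P e f} = 2"
    using assms(1) flags(1) by (auto simp: abstract_polyhedron_def flags_def)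
  consider "i = 0" | "i = 1" | "i = 2" using assms(2) by (auto simp: le_2_iff)
  then show ?thesis
  proof cases
    case 1
    then show ?thesis
      using assms(3,4) flags other_unique[OF card(1), of v v1 v2]
      by (auto simp: eq adjacent_flags_iff flags_def)
  next
    case 2
    then show ?thesis
      using assms(3,4) flags other_unique[OF card(3), of e e1 e2]
      by (auto simp: eq adjacent_flags_iff flags_def)
  next
    case 3
    then show ?thesis
      using assms(3,4) flags other_unique[OF card(2), of f f1 f2]
      by (auto simp: eq adjacent_flags_iff flags_def)
  qed
qed

lemma adjacent_flags_image:
  assumes "automorphism P g" "adjacent_flags P i \<Phi> \<Psi>"
  shows "adjacent_flags P i (flag_image g \<Phi>) (flag_image g \<Psi>)"
proof -
  obtain v e f v' e' f' where eq: "\<Phi> = (v, e, f)" "\<Psi> = (v', e', f')"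
    by (metis prod.exhaust)
  have preserves_rank: "g x \<in> elems P" "rk P (g x) = rk P x" if "x \<in> elems P" for x
    using assms(1) that by (auto simp: automorphism_def bij_betw_apply)
  have preserves_incidence: "incident P (g x) (g y) \<longleftrightarrow> incident P x y"
    if "x \<in> elems P" "y \<in> elems P" for x y
    using assms(1) that by (auto simp: automorphism_def)
  have injective: "g x = g y \<longleftrightarrow> x = y" if "x \<in> elems P" "y \<in> elems P" for x y
    using assms(1) that by (auto simp: automorphism_def bij_betw_def inj_on_def)
  have "v \<in> elems P" "e \<in> elems P" "f \<in> elems P" "v' \<in> elems P" "e' \<in> elems P" "f' \<in> elems P"
    using assms(2) by (auto simp: eq adjacent_flags_iff flags_def verts_def edges_def faces_def)
  then show ?thesis
    using assms(2) preserves_rank preserves_incidence injective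
    by (simp add: eq flag_image_def adjacent_flags_iff flags_def verts_def edges_def faces_def)
qed

lemma induced_connectedI:
  assumes "S \<subseteq> elems P" "c \<in> S"
    and "\<And>x. x \<in> S \<Longrightarrow> (c, x) \<in> {(u, v). u \<in> S \<and> v \<in> S \<and> v \<in> neighbours P u}\<^sup>*"
  shows "induced_connected P S"
proof -
  let ?R = "{(u, v). u \<in> S \<and> v \<in> S \<and> v \<in> neighbours P u}"
  have "sym ?R"
    using assms(1) incident_commute[of P] by (auto simp: sym_def neighbours_def)
  then have "(x, c) \<in> ?R\<^sup>*" if "x \<in> S" for x
    using assms(3)[OF that] by (meson sym_rtrancl symD)
  then show ?thesis
    unfolding induced_connected_def using assms(2,3) by (blast intro: rtrancl_trans)
qed

definition tight_chiral_type :: "nat \<Rightarrow> nat \<Rightarrow> bool" where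
  "tight_chiral_type p q \<longleftrightarrow>
    (\<exists>P :: nat ranked_poset. abstract_polyhedron P \<and> chiral P \<and> tight_of_type P p q)"

section \<open>Coset geometries of tight rotation groups\<close>

context group
begin

lemma generate_inv: "x \<in> carrier G \<Longrightarrow> generate G {inv x} = generate G {x}"
  using generate.inv[of x "{x}" G] generate.inv[of "inv x" "{inv x}" G]
  by (intro equalityI generate_subgroup_incl generate_is_subgroup) auto

lemma generate_involution:
  assumes "x \<in> carrier G" "x \<otimes> x = \<one>"
  shows "generate G {x} = {\<one>, x}"
proof
  have "inv x = x" using assms by (simp add: inv_equality)
  then have "subgroup {\<one>, x} G" using assms by (intro subgroupI) auto
  then show "generate G {x} \<subseteq> {\<one>, x}" by (intro generate_subgroup_incl) auto
  show "{\<one>, x} \<subseteq> generate G {x}" by (auto intro: generate.one generate.incl)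
qed

lemma l_coset_eq_iff:
  assumes "subgroup H G" "x \<in> carrier G" "y \<in> carrier G"
  shows "x <# H = y <# H \<longleftrightarrow> inv x \<otimes> y \<in> H"
proof
  assume "x <# H = y <# H"
  then have "y \<in> x <# H" using lcos_self[OF assms(3,1)] by simp
  then show "inv x \<otimes> y \<in> H" by (rule subgroup.lcos_module_imp[OF assms(1) is_group assms(2)])
next
  assume "inv x \<otimes> y \<in> H"
  then have "y \<in> x <# H" using subgroup.lcos_module_rev[OF assms(1) is_group assms(2,3)] by simp
  then show "x <# H = y <# H" by (rule l_repr_independence[OF _ assms(2,1)])
qed

lemma card_set_mult_disjoint:
  assumes "subgroup A G" "subgroup B G" "A \<inter> B = {\<one>}"
  shows "card (A <#> B) = card A * card B"
proof -
  interpret group_disjoint_sum G A B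
    by (intro group_disjoint_sum.intro is_group assms(1,2))
  have "inj_on (\<lambda>(x, y). x \<otimes> y) (A \<times> B)"
    using assms(3) cancel by (auto simp: inj_on_def)
  moreover have "A <#> B = (\<lambda>(x, y). x \<otimes> y) ` (A \<times> B)" by (auto simp: set_mult_def)
  ultimately show ?thesis by (simp add: card_image card_cartesian_product)
qed

lemma hom_inverting_generate:
  assumes "\<theta> \<in> hom G G" "x \<in> carrier G" "\<theta> x = inv x" "z \<in> generate G {x}"
  shows "\<theta> z = inv z"
proof -
  obtain n :: int where z: "z = x [^] n" using assms(2,4) by (auto simp: generate_pow)
  have "\<theta> z = \<theta> x [^] n" unfolding z by (rule hom_int_pow[OF assms(1,2) is_group is_group])
  then show ?thesis using assms(2,3) by (simp add: z int_pow_inv)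
qed

end

definition reflexible :: "('g, 'c) monoid_scheme \<Rightarrow> 'g \<Rightarrow> 'g \<Rightarrow> bool" where
  "reflexible G a b \<longleftrightarrow> (\<exists>\<theta>\<in>hom G G. \<theta> a = inv\<^bsub>G\<^esub> a \<and> \<theta> b = inv\<^bsub>G\<^esub> b)"

locale tight_rotation_group = group G for G (structure) +
  fixes a b
  assumes finite_carrier: "finite (carrier G)"
    and a_closed [simp, intro]: "a \<in> carrier G" and b_closed [simp, intro]: "b \<in> carrier G"
    and a_neq_one: "a \<noteq> \<one>" and b_neq_one: "b \<noteq> \<one>"
    and ab_involution: "(a \<otimes> b) \<otimes> (a \<otimes> b) = \<one>"
    and carrier_factorization: "carrier G = generate G {a} <#> generate G {b}"
    and trivial_intersection: "generate G {a} \<inter> generate G {b} = {\<one>}"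
begin

text \<open>Taking \<open>b\<inverse>\<close> instead of \<open>b\<close> makes the construction symmetric in the ranks \<open>0\<close> and \<open>2\<close>.\<close>

definition stab_gen :: "nat \<Rightarrow> 'a" where
  "stab_gen i = [inv b, a \<otimes> b, a] ! i"

definition stab :: "nat \<Rightarrow> 'a set" where
  "stab i = generate G {stab_gen i}"

lemma stab_gen_simps [simp]:
  "stab_gen 0 = inv b" "stab_gen 1 = a \<otimes> b" "stab_gen 2 = a"
  by (simp_all add: stab_gen_def numeral_2_eq_2 One_nat_def)

lemma stab_gen_closed [simp]: "i \<le> 2 \<Longrightarrow> stab_gen i \<in> carrier G"
  by (auto simp: le_2_iff)

lemma stab_0: "stab 0 = generate G {b}" and stab_1: "stab 1 = {\<one>, a \<otimes> b}"
  and stab_2: "stab 2 = generate G {a}"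
  by (simp_all add: stab_def generate_inv generate_involution ab_involution)

lemma subgroup_stab: "i \<le> 2 \<Longrightarrow> subgroup (stab i) G"
  unfolding stab_def by (simp add: generate_is_subgroup)

lemma stab_closed: "i \<le> 2 \<Longrightarrow> h \<in> stab i \<Longrightarrow> h \<in> carrier G"
  using subgroup_stab subgroup.mem_carrier by metis

lemma one_in_stab: "\<one> \<in> stab i" and stab_gen_in_stab: "stab_gen i \<in> stab i"
  unfolding stab_def by (simp_all add: generate.one generate.incl)

lemma stab_l_coset:
  assumes "i \<le> 2" "x \<in> carrier G"
  shows "x \<in> x <# stab i"
    and "y \<in> x <# stab i \<Longrightarrow> y \<in> carrier G"
    and "y \<in> x <# stab i \<Longrightarrow> h \<in> stab i \<Longrightarrow> y \<otimes> h \<in> x <# stab i"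
proof -
  show "x \<in> x <# stab i" using lcos_self[OF assms(2) subgroup_stab[OF assms(1)]] .
  show "y \<in> carrier G" if "y \<in> x <# stab i"
    using that assms stab_closed by (auto simp: l_coset_def)
  show "y \<otimes> h \<in> x <# stab i" if "y \<in> x <# stab i" "h \<in> stab i"
    using that assms stab_closed subgroup.m_closed[OF subgroup_stab[OF assms(1)]]
    by (auto simp: l_coset_def m_assoc)
qed

lemma aba_eq_inv_b: "a \<otimes> b \<otimes> a = inv b"
  by (rule inv_equality[symmetric]) (use ab_involution in \<open>simp_all add: m_assoc\<close>)

lemma bab_eq_inv_a: "b \<otimes> a \<otimes> b = inv a"
  by (rule inv_equality[symmetric], rule inv_comm) (use ab_involution in \<open>simp_all add: m_assoc\<close>)

lemma stab_gen_swap: "i \<in> {0, 2} \<Longrightarrow> stab_gen 1 \<otimes> stab_gen i = stab_gen (2 - i)"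
  using aba_eq_inv_b by (auto simp: m_assoc)

lemma stab_powers: "i \<le> 2 \<Longrightarrow> stab i = {stab_gen i [^] n | n. n \<in> (UNIV :: nat set)}"
  unfolding stab_def by (rule generate_pow_on_finite_carrier[OF finite_carrier stab_gen_closed])

lemma stab_inter:
  assumes "i \<le> 2" "j \<le> 2" "i \<noteq> j"
  shows "stab i \<inter> stab j = {\<one>}"
proof -
  have ends: "stab i \<inter> stab (2 - i) = {\<one>}" if "i \<in> {0, 2}" for i
    using that trivial_intersection by (elim insertE) (simp_all add: stab_0 stab_2 Int_commute)
  have middle: "stab 1 \<inter> stab i = {\<one>}" if i: "i \<in> {0, 2}" for i
  proof -
    have "a \<otimes> b \<notin> stab i"
    proof
      assume "a \<otimes> b \<in> stab i"
      then have "stab_gen 1 \<otimes> stab_gen i \<in> stab i"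
        using i by (intro subgroup.m_closed[OF subgroup_stab] stab_gen_in_stab) auto
      then have "stab_gen (2 - i) \<in> stab i \<inter> stab (2 - i)"
        using stab_gen_swap[OF i] stab_gen_in_stab by simp
      then have "stab_gen (2 - i) = \<one>" using ends[OF i] by simp
      then show False using i a_neq_one b_neq_one by auto
    qed
    then show ?thesis using one_in_stab[of i] unfolding stab_1 by blast
  qed
  consider "i = 1" "j \<in> {0, 2}" | "j = 1" "i \<in> {0, 2}" | "i \<in> {0, 2}" "j = 2 - i"
    using assms by (auto simp: le_2_iff)
  then show ?thesis
    by cases (use middle[of i] middle[of j] ends[of i] in \<open>simp_all add: Int_commute\<close>)
qed

lemma carrier_cases:
  assumes "g \<in> carrier G"
  obtains h k where "h \<in> generate G {a}" "k \<in> generate G {b}" "g = h \<otimes> k"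
  using assms that unfolding carrier_factorization set_mult_def by blast

lemma stab_factorization:
  assumes "i \<in> {0, 2}" "g \<in> carrier G"
  obtains h k where "h \<in> stab i" "k \<in> stab (2 - i)" "g = h \<otimes> k"
proof -
  consider "i = 2" | "i = 0" using assms(1) by auto
  then show thesis
  proof cases
    case 1
    obtain h k where "h \<in> stab 2" "k \<in> stab 0" "g = h \<otimes> k"
      using assms(2) unfolding stab_0 stab_2 by (rule carrier_cases)
    then show thesis using that 1 by simp
  next
    case 2
    obtain h k where hk: "h \<in> stab 2" "k \<in> stab 0" "inv g = h \<otimes> k"
      using inv_closed[OF assms(2)] unfolding stab_0 stab_2 by (rule carrier_cases)
    have "h \<in> carrier G" "k \<in> carrier G"
      using hk(1,2) stab_closed[of 2 h] stab_closed[of 0 k] by auto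
    then have "g = inv k \<otimes> inv h" using assms(2) inv_mult_group[of h k] hk(3)[symmetric] by simp
    moreover have "inv k \<in> stab 0" "inv h \<in> stab 2"
      using hk(1,2) by (auto intro: subgroup.m_inv_closed[OF subgroup_stab])
    ultimately show thesis using that 2 by simp
  qed
qed

definition node :: "nat \<Rightarrow> 'a \<Rightarrow> nat" where
  "node i x = prod_encode (i, to_nat_on (Pow (carrier G)) (x <# stab i))"

definition coset_poset :: "nat ranked_poset" where
  "coset_poset =
    \<lparr>elems = (\<Union>i\<le>2. node i ` carrier G),
     le_rel = {(node i x, node j x) | i j x. i \<le> j \<and> j \<le> 2 \<and> x \<in> carrier G},
     rk = (\<lambda>n. fst (prod_decode n))\<rparr>"

lemma node_eq_iff:
  assumes "i \<le> 2" "j \<le> 2" "x \<in> carrier G" "y \<in> carrier G"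
  shows "node i x = node j y \<longleftrightarrow> i = j \<and> inv x \<otimes> y \<in> stab i"
proof -
  have "z <# stab k \<in> Pow (carrier G)" if "k \<le> 2" "z \<in> carrier G" for k z
    using l_coset_subset_G[OF subgroup.subset[OF subgroup_stab]] that by simp
  moreover have "inj_on (to_nat_on (Pow (carrier G))) (Pow (carrier G))"
    using finite_carrier by (intro inj_on_to_nat_on countable_finite) simp
  ultimately have "node i x = node j y \<longleftrightarrow> i = j \<and> x <# stab i = y <# stab i"
    using assms by (auto simp: node_def inj_on_eq_iff)
  then show ?thesis using l_coset_eq_iff[OF subgroup_stab] assms by simp
qed

lemma node_mult_stab [simp]:
  "i \<le> 2 \<Longrightarrow> x \<in> carrier G \<Longrightarrow> h \<in> stab i \<Longrightarrow> node i (x \<otimes> h) = node i x"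
  using stab_closed[of i h] subgroup.m_inv_closed[OF subgroup_stab, of i h]
  by (simp add: node_eq_iff inv_mult_group m_assoc)

lemma node_eq_obtain:
  assumes "node i x = node i y" "i \<le> 2" "x \<in> carrier G" "y \<in> carrier G"
  obtains h where "h \<in> stab i" "y = x \<otimes> h"
proof
  show "inv x \<otimes> y \<in> stab i" using assms node_eq_iff by simp
  show "y = x \<otimes> (inv x \<otimes> y)" using assms by (simp add: m_assoc[symmetric])
qed

lemma rk_node [simp]: "rk coset_poset (node i x) = i"
  by (simp add: coset_poset_def node_def)

lemma elems_coset_poset: "elems coset_poset = (\<Union>i\<le>2. node i ` carrier G)"
  by (simp add: coset_poset_def)

lemma node_in_elems [simp]: "i \<le> 2 \<Longrightarrow> x \<in> carrier G \<Longrightarrow> node i x \<in> elems coset_poset"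
  by (auto simp: elems_coset_poset)

lemma verts_coset_poset: "verts coset_poset = node 0 ` carrier G"
  and edges_coset_poset: "edges coset_poset = node 1 ` carrier G"
  and faces_coset_poset: "faces coset_poset = node 2 ` carrier G"
  by (auto simp: verts_def edges_def faces_def elems_coset_poset)

lemma le_rel_node:
  "i \<le> j \<Longrightarrow> j \<le> 2 \<Longrightarrow> x \<in> carrier G \<Longrightarrow> (node i x, node j x) \<in> le_rel coset_poset"
  by (auto simp: coset_poset_def)

lemma le_rel_cases:
  assumes "(u, v) \<in> le_rel coset_poset"
  obtains i j x where "u = node i x" "v = node j x" "i \<le> j" "j \<le> 2" "x \<in> carrier G"
  using assms by (auto simp: coset_poset_def)

lemma incident_coset_poset_iff:
  "incident coset_poset y z \<longleftrightarrow>
    (\<exists>i j x. i \<le> 2 \<and> j \<le> 2 \<and> x \<in> carrier G \<and> y = node i x \<and> z = node j x)"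
proof
  assume "incident coset_poset y z"
  then consider "(y, z) \<in> le_rel coset_poset" | "(z, y) \<in> le_rel coset_poset"
    by (auto simp: incident_def)
  then show "\<exists>i j x. i \<le> 2 \<and> j \<le> 2 \<and> x \<in> carrier G \<and> y = node i x \<and> z = node j x"
    by cases (meson le_rel_cases le_trans)+
next
  assume "\<exists>i j x. i \<le> 2 \<and> j \<le> 2 \<and> x \<in> carrier G \<and> y = node i x \<and> z = node j x"
  then obtain i j x where "i \<le> 2" "j \<le> 2" "x \<in> carrier G" "y = node i x" "z = node j x" by blast
  then show "incident coset_poset y z"
    using le_rel_node[of i j x] le_rel_node[of j i x] linear[of i j] by (auto simp: incident_def)
qed

lemma incident_node [simp]:
  "i \<le> 2 \<Longrightarrow> j \<le> 2 \<Longrightarrow> x \<in> carrier G \<Longrightarrow> incident coset_poset (node i x) (node j x)"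
  unfolding incident_coset_poset_iff by blast

lemma incident_node_iff:
  assumes "i \<le> 2" "j \<le> 2" "x \<in> carrier G" "z \<in> carrier G"
  shows "incident coset_poset (node i z) (node j x) \<longleftrightarrow> node i z \<in> node i ` (x <# stab j)"
proof
  assume "incident coset_poset (node i z) (node j x)"
  then obtain w where w: "w \<in> carrier G" "node i z = node i w" "node j x = node j w"
    unfolding incident_coset_poset_iff by (metis rk_node)
  then obtain h where "h \<in> stab j" "w = x \<otimes> h"
    using assms node_eq_obtain by metis
  then show "node i z \<in> node i ` (x <# stab j)" using w(2) by (auto simp: l_coset_def)
next
  assume "node i z \<in> node i ` (x <# stab j)"
  then obtain h where h: "h \<in> stab j" "node i z = node i (x \<otimes> h)" by (auto simp: l_coset_def)
  then have "incident coset_poset (node i z) (node j (x \<otimes> h))"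
    using assms stab_closed[of j h] incident_node[of i j "x \<otimes> h"] by (simp del: node_mult_stab)
  then show "incident coset_poset (node i z) (node j x)"
    unfolding node_mult_stab[OF assms(2,3) h(1)] .
qed

lemma inj_on_node_l_coset:
  assumes "i \<le> 2" "j \<le> 2" "i \<noteq> j" "x \<in> carrier G"
  shows "inj_on (node i) (x <# stab j)"
proof (rule inj_onI)
  fix y z assume "y \<in> x <# stab j" "z \<in> x <# stab j" and eq: "node i y = node i z"
  then obtain h k where hk: "h \<in> stab j" "k \<in> stab j" "y = x \<otimes> h" "z = x \<otimes> k"
    by (auto simp: l_coset_def)
  have closed: "h \<in> carrier G" "k \<in> carrier G" using hk(1,2) assms(2) stab_closed by auto
  have "inv y \<otimes> z \<in> stab i" using eq assms hk closed by (simp add: node_eq_iff)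
  moreover have "inv y \<otimes> z = inv h \<otimes> k"
    using assms hk closed by (simp add: inv_mult_group m_assoc inv_solve_left')
  moreover have "inv h \<otimes> k \<in> stab j"
    using hk subgroup_stab[OF assms(2)] by (simp add: subgroup.m_closed subgroup.m_inv_closed)
  ultimately have "inv h \<otimes> k = \<one>" using stab_inter[OF assms(1-3)] by auto
  then show "y = z" using closed hk by (metis inv_closed inv_equality inv_inv)
qed

lemma card_incident_nodes:
  assumes "i \<le> 2" "j \<le> 2" "i \<noteq> j" "x \<in> carrier G"
  shows "finite (node i ` (x <# stab j))" and "card (node i ` (x <# stab j)) = card (stab j)"
proof -
  have sub: "stab j \<subseteq> carrier G" using assms(2) stab_closed by blast
  then show "finite (node i ` (x <# stab j))"
    using finite_carrier l_coset_subset_G[OF sub assms(4)] by (meson finite_imageI finite_subset)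
  have "x <# stab j = (\<otimes>) x ` stab j" by (auto simp: l_coset_def)
  then have "card (x <# stab j) = card (stab j)"
    using inj_on_subset[OF inj_on_cmult[OF assms(4)] sub] by (simp add: card_image)
  then show "card (node i ` (x <# stab j)) = card (stab j)"
    using card_image[OF inj_on_node_l_coset[OF assms]] by simp
qed

lemma node_0_2_common:
  assumes "x \<in> carrier G" "y \<in> carrier G"
  obtains z where "z \<in> carrier G" "node 0 x = node 0 z" "node 2 y = node 2 z"
proof -
  obtain h k where hk: "h \<in> stab 0" "k \<in> stab 2" "inv x \<otimes> y = h \<otimes> k"
    using stab_factorization[of 0 "inv x \<otimes> y"] assms by auto
  have closed: "h \<in> carrier G" "k \<in> carrier G"
    using hk(1,2) stab_closed[of 0 h] stab_closed[of 2 k] by auto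
  then have "y = (x \<otimes> h) \<otimes> k" using assms hk(3) by (simp add: m_assoc inv_solve_left')
  then show thesis using that[of "x \<otimes> h"] assms hk closed by simp
qed

lemma rk_strict_mono:
  "(u, v) \<in> le_rel coset_poset \<Longrightarrow> u \<noteq> v \<Longrightarrow> rk coset_poset u < rk coset_poset v"
proof -
  assume "(u, v) \<in> le_rel coset_poset" "u \<noteq> v"
  then obtain i j x where "u = node i x" "v = node j x" "i \<le> j" by (elim le_rel_cases)
  then show "rk coset_poset u < rk coset_poset v" using \<open>u \<noteq> v\<close> by (cases "i = j") simp_all
qed

lemma partial_order_coset_poset: "partial_order_on (elems coset_poset) (le_rel coset_poset)"
proof -
  have "trans (le_rel coset_poset)"
  proof (rule transI)
    fix u v w assume "(u, v) \<in> le_rel coset_poset" "(v, w) \<in> le_rel coset_poset"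
    then obtain i j j' k x y where ijk: "i \<le> j" "j' \<le> k" "k \<le> 2"
      and xy: "x \<in> carrier G" "y \<in> carrier G"
      and eq: "u = node i x" "v = node j x" "v = node j' y" "w = node k y"
      by (elim le_rel_cases)
    have "j' = j" using eq(2,3) rk_node by metis
    consider "i = j" | "j = k" | "i = 0" "k = 2" using ijk \<open>j' = j\<close> by linarith
    then show "(u, w) \<in> le_rel coset_poset"
    proof cases
      case 1
      then have "u = node j' y" using eq by metis
      then show ?thesis using le_rel_node[of j' k y] ijk xy(2) eq(4) by simp
    next
      case 2
      then have "w = node j x" using eq \<open>j' = j\<close> by metis
      then show ?thesis using le_rel_node[of i j x] ijk xy(1) eq(1) 2 by simp
    next
      case 3
      obtain z where "z \<in> carrier G" "node 0 x = node 0 z" "node 2 y = node 2 z"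
        using node_0_2_common[OF xy] .
      then show ?thesis using le_rel_node[of 0 2 z] eq(1,4) 3 by simp
    qed
  qed
  moreover have "antisym (le_rel coset_poset)"
    using rk_strict_mono less_asym by (metis antisymI)
  moreover have "refl_on (elems coset_poset) (le_rel coset_poset)"
    using le_rel_node by (auto intro!: refl_onI simp: elems_coset_poset)
  moreover have "le_rel coset_poset \<subseteq> elems coset_poset \<times> elems coset_poset"
    by (auto elim!: le_rel_cases)
  ultimately show ?thesis by (simp add: partial_order_on_def preorder_on_def)
qed

lemma node_mult_eq_iff:
  "i \<le> 2 \<Longrightarrow> x \<in> carrier G \<Longrightarrow> h \<in> carrier G \<Longrightarrow> node i (x \<otimes> h) = node i x \<longleftrightarrow> h \<in> stab i"
  using node_eq_iff[of i i x "x \<otimes> h"] by (auto simp: m_assoc[symmetric])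

lemma nodes_incident_to_node:
  assumes "i \<le> 2" "j \<le> 2" "x \<in> carrier G"
  shows "{y \<in> node i ` carrier G. incident coset_poset y (node j x)} = node i ` (x <# stab j)"
    and "{y \<in> node i ` carrier G. incident coset_poset (node j x) y} = node i ` (x <# stab j)"
  using stab_l_coset(2)[OF assms(2,3)]
  by (auto simp: incident_node_iff incident_commute[of _ "node j x"] assms)

lemma stab_disjoint:
  "i \<le> 2 \<Longrightarrow> j \<le> 2 \<Longrightarrow> h \<in> stab i \<Longrightarrow> h \<noteq> \<one> \<Longrightarrow> h \<in> stab j \<longleftrightarrow> j = i"
  using stab_inter[of i j] by blast

lemma a_in_stab_iff: "i \<le> 2 \<Longrightarrow> a \<in> stab i \<longleftrightarrow> i = 2"
  and b_in_stab_iff: "i \<le> 2 \<Longrightarrow> b \<in> stab i \<longleftrightarrow> i = 0"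
  using stab_disjoint[of 2 i a] stab_disjoint[of 0 i b] a_neq_one b_neq_one
  by (simp_all add: stab_0 stab_2 generate.incl)

lemma node_1_mult_b: "x \<in> carrier G \<Longrightarrow> node 1 (x \<otimes> b) = node 1 (x \<otimes> inv a)"
  using node_mult_stab[of 1 "x \<otimes> b", OF _ _ stab_gen_in_stab]
  by (simp add: bab_eq_inv_a[symmetric] m_assoc)

lemma node_1_common_cases:
  assumes "x \<in> carrier G" "h \<in> stab 0" "k \<in> stab 2" "node 1 (x \<otimes> h) = node 1 (x \<otimes> k)"
  shows "h = \<one> \<or> h = b"
proof -
  have closed: "h \<in> carrier G" "k \<in> carrier G"
    using assms(2,3) stab_closed[of 0 h] stab_closed[of 2 k] by auto
  obtain t where t: "t \<in> stab 1" "x \<otimes> k = (x \<otimes> h) \<otimes> t"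
    using assms closed node_eq_obtain[of 1 "x \<otimes> h" "x \<otimes> k"] by auto
  then have k: "k = h \<otimes> t" using assms(1) closed by (auto simp: stab_1 m_assoc)
  consider "t = \<one>" | "t = a \<otimes> b" using t(1) by (auto simp: stab_1)
  then show ?thesis
  proof cases
    case 1
    then show ?thesis using assms(2,3) k closed stab_inter[of 0 2] by auto
  next
    case 2
    have "h \<otimes> inv b = k \<otimes> a" using k closed aba_eq_inv_b by (simp add: 2 m_assoc)
    moreover have "h \<otimes> inv b \<in> stab 0"
      using assms(2) stab_gen_in_stab[of 0] subgroup.m_closed[OF subgroup_stab[of 0]] by simp
    moreover have "k \<otimes> a \<in> stab 2"
      using assms(3) stab_gen_in_stab[of 2] subgroup.m_closed[OF subgroup_stab[of 2]] by simp
    ultimately have "h \<otimes> inv b = \<one>" using stab_inter[of 0 2] by auto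
    then show ?thesis using closed by (simp add: inv_solve_right')
  qed
qed

lemma edges_at_vertex_face:
  assumes "x \<in> carrier G"
  shows "{e \<in> edges coset_poset. incident coset_poset (node 0 x) e \<and>
      incident coset_poset e (node 2 x)} = {node 1 x, node 1 (x \<otimes> b)}"
proof -
  note in_coset = stab_l_coset[OF _ assms]
  have "x \<otimes> inv a \<in> x <# stab 2" "x \<otimes> b \<in> x <# stab 0"
    using in_coset(3)[OF _ in_coset(1), of 2 "inv a"] in_coset(3)[OF _ in_coset(1), of 0 b]
      generate.inv[of a "{a}" G] generate.incl[of b "{b}" G] by (simp_all add: stab_0 stab_2)
  then have "{node 1 x, node 1 (x \<otimes> b)} \<subseteq> node 1 ` (x <# stab 0) \<inter> node 1 ` (x <# stab 2)"
    using in_coset(1)[of 0] in_coset(1)[of 2] node_1_mult_b[OF assms] by (auto intro: rev_image_eqI)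
  moreover have "node 1 ` (x <# stab 0) \<inter> node 1 ` (x <# stab 2) \<subseteq> {node 1 x, node 1 (x \<otimes> b)}"
  proof
    fix e assume "e \<in> node 1 ` (x <# stab 0) \<inter> node 1 ` (x <# stab 2)"
    then obtain h k
      where hk: "h \<in> stab 0" "k \<in> stab 2" "e = node 1 (x \<otimes> h)" "e = node 1 (x \<otimes> k)"
      by (auto simp: l_coset_def)
    then have "h = \<one> \<or> h = b" using node_1_common_cases[OF assms hk(1,2)] by simp
    then show "e \<in> {node 1 x, node 1 (x \<otimes> b)}" using hk(3) assms by auto
  qed
  ultimately have "node 1 ` (x <# stab 0) \<inter> node 1 ` (x <# stab 2) = {node 1 x, node 1 (x \<otimes> b)}"
    by (rule equalityI[rotated])
  then show ?thesis
    using nodes_incident_to_node(2)[of 1 0 x, symmetric]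
      nodes_incident_to_node(1)[of 1 2 x, symmetric] assms
    by (simp add: edges_coset_poset) blast
qed

lemma connected_coset_poset: "induced_connected coset_poset (elems coset_poset)"
proof (rule induced_connectedI)
  let ?S = "elems coset_poset"
  let ?R = "{(u, v). u \<in> ?S \<and> v \<in> ?S \<and> v \<in> neighbours coset_poset u}"
  have step: "(node i x, node j x) \<in> ?R\<^sup>*" if "i \<le> 2" "j \<le> 2" "x \<in> carrier G" for i j x
    using that by (cases "i = j") (auto simp: neighbours_def node_eq_iff)
  fix u assume "u \<in> ?S"
  then obtain i x where u: "u = node i x" "i \<le> 2" "x \<in> carrier G" by (auto simp: elems_coset_poset)
  obtain z where z: "z \<in> carrier G" "node 0 \<one> = node 0 z" "node 2 x = node 2 z"
    using node_0_2_common[of \<one> x] u(3) by auto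
  have "(node 0 \<one>, node 2 x) \<in> ?R\<^sup>*" using step[of 0 2 z] z by simp
  also have "(node 2 x, u) \<in> ?R\<^sup>*" using step[of 2 i x] u by simp
  finally show "(node 0 \<one>, u) \<in> ?R\<^sup>*" .
qed auto

lemma neighbours_node:
  assumes "j \<le> 2" "x \<in> carrier G"
  shows "neighbours coset_poset (node j x) = (\<Union>i\<in>{..2} - {j}. node i ` (x <# stab j))"
proof (intro equalityI subsetI)
  fix y assume "y \<in> neighbours coset_poset (node j x)"
  then have y: "y \<in> elems coset_poset" "incident coset_poset y (node j x)" "y \<noteq> node j x"
    by (auto simp: neighbours_def incident_commute)
  then obtain i z where z: "y = node i z" "i \<le> 2" "z \<in> carrier G" by (auto simp: elems_coset_poset)
  then have "y \<in> node i ` (x <# stab j)" using y(2) assms by (simp add: incident_node_iff)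
  moreover have "i \<noteq> j" using calculation y(3) assms by (auto simp: l_coset_def)
  ultimately show "y \<in> (\<Union>i\<in>{..2} - {j}. node i ` (x <# stab j))" using z(2) by blast
next
  fix y assume "y \<in> (\<Union>i\<in>{..2} - {j}. node i ` (x <# stab j))"
  then obtain i z where z: "i \<le> 2" "i \<noteq> j" "z \<in> x <# stab j" "y = node i z" by auto
  then have "incident coset_poset y (node j x)"
    using assms stab_l_coset(2)[of j x z] by (simp add: incident_node_iff)
  then show "y \<in> neighbours coset_poset (node j x)"
    using z assms stab_l_coset(2)[of j x z]
    by (auto simp: neighbours_def incident_commute node_eq_iff)
qed

lemma incident_node_turn:
  assumes "j \<in> {0, 2}" "y \<in> carrier G"
  shows "incident coset_poset (node 1 y) (node (2 - j) (y \<otimes> stab_gen j))"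
proof -
  let ?i = "2 - j" and ?y = "y \<otimes> stab_gen 1"
  have "?i \<in> {0, 2}" "j \<le> 2" "2 - ?i = j" using assms(1) by auto
  then have "node ?i (y \<otimes> stab_gen j) = node ?i (?y \<otimes> stab_gen ?i)"
    using stab_gen_swap[of ?i] assms(2) by (simp add: m_assoc del: stab_gen_simps)
  also have "\<dots> = node ?i ?y" using assms(2) stab_gen_in_stab[of ?i] by simp
  finally have "node ?i (y \<otimes> stab_gen j) = node ?i ?y" .
  moreover have "node 1 y = node 1 ?y"
    using node_mult_stab[OF _ assms(2) stab_gen_in_stab[of 1]] by simp
  ultimately show ?thesis using incident_node[of 1 ?i ?y] assms(2) by simp
qed

definition link_adjacency :: "nat \<Rightarrow> 'a \<Rightarrow> nat rel" where
  "link_adjacency j x = {(u, v). u \<in> neighbours coset_poset (node j x) \<and>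
    v \<in> neighbours coset_poset (node j x) \<and> v \<in> neighbours coset_poset u}"

lemma link_adjacencyI:
  assumes "j \<in> {0, 2}" "x \<in> carrier G" "y \<in> x <# stab j" "z \<in> x <# stab j"
    and "incident coset_poset (node 1 y) (node (2 - j) z)"
  shows "(node 1 y, node (2 - j) z) \<in> link_adjacency j x"
    and "(node (2 - j) z, node 1 y) \<in> link_adjacency j x"
proof -
  have j: "j \<le> 2" "2 - j \<noteq> j" "j \<noteq> 1" "2 - j \<noteq> 1" using assms(1) by auto
  have "node 1 y \<in> neighbours coset_poset (node j x)"
    "node (2 - j) z \<in> neighbours coset_poset (node j x)"
    using neighbours_node[OF j(1) assms(2)] assms(3,4) j by auto
  moreover have "node (2 - j) z \<in> neighbours coset_poset (node 1 y)"
    "node 1 y \<in> neighbours coset_poset (node (2 - j) z)"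
    using assms(5) j stab_l_coset(2)[OF j(1) assms(2)] assms(3,4)
    by (simp_all add: neighbours_def incident_commute node_eq_iff)
  ultimately show "(node 1 y, node (2 - j) z) \<in> link_adjacency j x"
    "(node (2 - j) z, node 1 y) \<in> link_adjacency j x"
    by (simp_all add: link_adjacency_def)
qed

lemma link_walk:
  assumes "j \<in> {0, 2}" "x \<in> carrier G"
  shows "(node 1 x, node 1 (x \<otimes> stab_gen j [^] (n :: nat))) \<in> (link_adjacency j x)\<^sup>*"
proof (induction n)
  case 0
  then show ?case using assms(2) by simp
next
  case (Suc n)
  have j: "j \<le> 2" using assms(1) by auto
  note coset = stab_l_coset[OF j assms(2)]
  let ?y = "x \<otimes> stab_gen j [^] n" and ?z = "x \<otimes> stab_gen j [^] Suc n"
  have "x \<otimes> stab_gen j [^] m \<in> x <# stab j" for m :: nat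
    using stab_powers[OF j] by (auto simp: l_coset_def)
  then have y: "?y \<in> x <# stab j" "?z \<in> x <# stab j" by blast+
  have z: "?z = ?y \<otimes> stab_gen j" using assms(2) j by (simp add: m_assoc)
  have "(node 1 ?y, node (2 - j) ?z) \<in> link_adjacency j x"
    using link_adjacencyI(1)[OF assms y] incident_node_turn[OF assms(1) coset(2)[OF y(1)]]
    unfolding z by simp
  moreover have "(node (2 - j) ?z, node 1 ?z) \<in> link_adjacency j x"
    using link_adjacencyI(2)[OF assms y(2) y(2)] coset(2)[OF y(2)] by simp
  ultimately show ?case using Suc by (meson rtrancl.rtrancl_into_rtrancl)
qed

lemma connected_neighbours:
  assumes "j \<in> {0, 2}" "x \<in> carrier G"
  shows "induced_connected coset_poset (neighbours coset_poset (node j x))"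
proof (rule induced_connectedI)
  have j: "j \<le> 2" using assms(1) by auto
  fix u assume "u \<in> neighbours coset_poset (node j x)"
  then obtain k y where y: "k \<le> 2" "k \<noteq> j" "y \<in> x <# stab j" "u = node k y"
    using neighbours_node[OF j assms(2)] by auto
  then have "(node 1 x, node 1 y) \<in> (link_adjacency j x)\<^sup>*"
    using link_walk[OF assms] stab_powers[OF j] by (auto simp: l_coset_def)
  also have "k = 1 \<or> k = 2 - j" using y(1,2) assms(1) by (auto simp: le_2_iff)
  then have "(node 1 y, u) \<in> (link_adjacency j x)\<^sup>*"
    using link_adjacencyI(1)[OF assms y(3) y(3)] y(4) stab_l_coset(2)[OF j assms(2) y(3)] by auto
  finally show "(node 1 x, u) \<in> {(u, v). u \<in> neighbours coset_poset (node j x) \<and>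
      v \<in> neighbours coset_poset (node j x) \<and> v \<in> neighbours coset_poset u}\<^sup>*"
    unfolding link_adjacency_def .
next
  show "node 1 x \<in> neighbours coset_poset (node j x)"
    using assms by (auto simp: neighbours_def incident_commute node_eq_iff)
qed (auto simp: neighbours_def)

lemma card_stab_1: "card (stab 1) = 2"
proof -
  have "a \<otimes> b \<noteq> \<one>" using inv_equality[of a b] stab_gen_in_stab[of 0] a_in_stab_iff[of 0] by auto
  then show ?thesis by (auto simp: stab_1)
qed

lemma vertex_face_common:
  assumes "v \<in> verts coset_poset" "f \<in> faces coset_poset"
  obtains x where "x \<in> carrier G" "v = node 0 x" "f = node 2 x"
proof -
  obtain y z where yz: "v = node 0 y" "f = node 2 z" "y \<in> carrier G" "z \<in> carrier G"
    using assms unfolding verts_coset_poset faces_coset_poset by blast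
  obtain x where "x \<in> carrier G" "node 0 y = node 0 x" "node 2 z = node 2 x"
    using node_0_2_common[OF yz(3,4)] .
  then show thesis using that yz(1,2) by simp
qed

lemma abstract_polyhedron_coset_poset: "abstract_polyhedron coset_poset"
proof -
  have "card {v \<in> verts coset_poset. incident coset_poset v e} = 2 \<and>
      card {f \<in> faces coset_poset. incident coset_poset e f} = 2"
    if e: "e \<in> edges coset_poset" for e
  proof -
    obtain x where x: "e = node 1 x" "x \<in> carrier G" using e unfolding edges_coset_poset by blast
    then show ?thesis
      using card_incident_nodes(2)[of 0 1 x] card_incident_nodes(2)[of 2 1 x] card_stab_1
      by (simp add: verts_coset_poset faces_coset_poset nodes_incident_to_node)
  qed
  moreover have
    "card {e \<in> edges coset_poset. incident coset_poset v e \<and> incident coset_poset e f} = 2"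
    if vf: "v \<in> verts coset_poset" "f \<in> faces coset_poset" for v f
  proof -
    obtain x where "x \<in> carrier G" "v = node 0 x" "f = node 2 x"
      using vertex_face_common[OF vf] .
    moreover have "node 1 x \<noteq> node 1 (x \<otimes> b)"
      using calculation(1) node_mult_eq_iff[of 1 x b] b_in_stab_iff[of 1] by auto
    ultimately show ?thesis using edges_at_vertex_face[of x] by simp
  qed
  moreover have "induced_connected coset_poset (neighbours coset_poset x)"
    if "x \<in> verts coset_poset \<union> faces coset_poset" for x
    using that connected_neighbours unfolding verts_coset_poset faces_coset_poset by blast
  moreover have "\<forall>x\<in>elems coset_poset. rk coset_poset x \<in> {0, 1, 2}"
    by (auto simp: elems_coset_poset le_2_iff)
  ultimately show ?thesis
    unfolding abstract_polyhedron_def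
    using partial_order_coset_poset rk_strict_mono connected_coset_poset by simp
qed

definition pos_flag :: "'a \<Rightarrow> nat \<times> nat \<times> nat" where
  "pos_flag x = (node 0 x, node 1 x, node 2 x)"

definition neg_flag :: "'a \<Rightarrow> nat \<times> nat \<times> nat" where
  "neg_flag x = (node 0 x, node 1 (x \<otimes> b), node 2 x)"

lemma flags_coset_poset: "flags coset_poset = pos_flag ` carrier G \<union> neg_flag ` carrier G"
proof (intro equalityI subsetI)
  fix \<Phi> assume "\<Phi> \<in> flags coset_poset"
  then obtain v e f where \<Phi>: "\<Phi> = (v, e, f)" "v \<in> verts coset_poset" "f \<in> faces coset_poset"
    and e: "e \<in> edges coset_poset" "incident coset_poset v e" "incident coset_poset e f"
    by (auto simp: flags_def)
  obtain x where x: "x \<in> carrier G" "v = node 0 x" "f = node 2 x"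
    using vertex_face_common[OF \<Phi>(2,3)] .
  then have "e = node 1 x \<or> e = node 1 (x \<otimes> b)" using e edges_at_vertex_face[OF x(1)] by auto
  then show "\<Phi> \<in> pos_flag ` carrier G \<union> neg_flag ` carrier G"
    using \<Phi>(1) x by (auto simp: pos_flag_def neg_flag_def)
next
  fix \<Phi> assume "\<Phi> \<in> pos_flag ` carrier G \<union> neg_flag ` carrier G"
  then obtain x e
    where x: "x \<in> carrier G" "e \<in> {node 1 x, node 1 (x \<otimes> b)}" "\<Phi> = (node 0 x, e, node 2 x)"
    by (auto simp: pos_flag_def neg_flag_def)
  then show "\<Phi> \<in> flags coset_poset"
    using edges_at_vertex_face[OF x(1)]
    by (auto simp: flags_def verts_coset_poset faces_coset_poset)
qed

lemma node_0_2_inject: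
  assumes "x \<in> carrier G" "y \<in> carrier G" "node 0 x = node 0 y" "node 2 x = node 2 y"
  shows "x = y"
proof -
  have "inv x \<otimes> y \<in> stab 0 \<inter> stab 2" using assms by (simp add: node_eq_iff)
  then have "inv x \<otimes> y = \<one>" using stab_inter[of 0 2] by simp
  moreover have "y = x \<otimes> (inv x \<otimes> y)" using assms by (simp add: m_assoc[symmetric])
  ultimately show "x = y" using assms by simp
qed

lemma inj_on_pos_flag: "inj_on pos_flag (carrier G)"
  and inj_on_neg_flag: "inj_on neg_flag (carrier G)"
  using node_0_2_inject by (auto simp: inj_on_def pos_flag_def neg_flag_def)

lemma pos_neg_flags_disjoint: "pos_flag ` carrier G \<inter> neg_flag ` carrier G = {}"
proof -
  have "pos_flag x \<noteq> neg_flag y" if "x \<in> carrier G" "y \<in> carrier G" for x y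
    using that node_0_2_inject[OF that] node_mult_eq_iff[of 1 x b] b_in_stab_iff[of 1]
    by (auto simp: pos_flag_def neg_flag_def)
  then show ?thesis by blast
qed

lemma tight_coset_poset:
  "tight_of_type coset_poset (card (generate G {a})) (card (generate G {b}))"
proof -
  have "card (carrier G) = card (generate G {a}) * card (generate G {b})"
    unfolding carrier_factorization
    by (intro card_set_mult_disjoint generate_is_subgroup trivial_intersection) auto
  then have "finite (flags coset_poset)"
    "card (flags coset_poset) = 2 * card (generate G {a}) * card (generate G {b})"
    using card_Un_disjoint[OF _ _ pos_neg_flags_disjoint] finite_carrier
      card_image[OF inj_on_pos_flag] card_image[OF inj_on_neg_flag]
    by (simp_all add: flags_coset_poset)
  moreover have "of_type coset_poset (card (stab 2)) (card (stab 0))"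
    unfolding of_type_def verts_coset_poset edges_coset_poset faces_coset_poset
    using card_incident_nodes[of 1 0] card_incident_nodes[of 1 2]
    by (simp add: nodes_incident_to_node)
  ultimately show ?thesis by (simp add: tight_of_type_def stab_0 stab_2)
qed

definition adj_step :: "nat \<Rightarrow> 'a" where
  "adj_step i = [a, \<one>, inv b] ! i"

lemma adj_step_simps [simp]: "adj_step 0 = a" "adj_step 1 = \<one>" "adj_step 2 = inv b"
  by (simp_all add: adj_step_def numeral_2_eq_2 One_nat_def)

lemma adj_step_closed [simp]: "i \<le> 2 \<Longrightarrow> adj_step i \<in> carrier G"
  by (auto simp: le_2_iff)

lemma adjacent_pos_neg:
  assumes "i \<le> 2" "x \<in> carrier G"
  shows "adjacent_flags coset_poset i (pos_flag x) (neg_flag (x \<otimes> adj_step i))"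
proof -
  have "pos_flag x \<in> flags coset_poset" "neg_flag (x \<otimes> adj_step i) \<in> flags coset_poset"
    using assms by (simp_all add: flags_coset_poset)
  moreover have
    "node 0 (x \<otimes> a) \<noteq> node 0 x" "node 1 (x \<otimes> a \<otimes> b) = node 1 x" "node 2 (x \<otimes> a) = node 2 x"
    using assms(2) stab_gen_in_stab[of 1] by (simp_all add: m_assoc a_in_stab_iff node_mult_eq_iff)
  moreover have "node 1 (x \<otimes> b) \<noteq> node 1 x"
    using assms(2) b_in_stab_iff[of 1] by (simp add: node_mult_eq_iff)
  moreover have "node 0 (x \<otimes> inv b) = node 0 x" "node 2 (x \<otimes> inv b) \<noteq> node 2 x"
    using assms(2) stab_disjoint[of 0 2 "inv b"] stab_gen_in_stab[of 0] b_neq_one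
    by (simp_all add: node_mult_eq_iff)
  moreover have "x \<otimes> inv b \<otimes> b = x" using assms(2) by (simp add: m_assoc)
  ultimately show ?thesis
    using assms(1) unfolding le_2_iff
    by (elim disjE) (simp_all add: pos_flag_def neg_flag_def adjacent_flags_iff assms(2))
qed

lemma adjacent_neg_pos:
  assumes "i \<le> 2" "x \<in> carrier G"
  shows "adjacent_flags coset_poset i (neg_flag x) (pos_flag (x \<otimes> inv (adj_step i)))"
  using adjacent_flags_sym[OF adjacent_pos_neg[OF assms(1), of "x \<otimes> inv (adj_step i)"]] assms
  by (simp add: m_assoc)

lemma adjacent_flags_alternate:
  assumes "adjacent_flags coset_poset i \<Phi> \<Psi>" "i \<le> 2"
  shows "\<Phi> \<in> pos_flag ` carrier G \<and> \<Psi> \<in> neg_flag ` carrier G \<or>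
    \<Phi> \<in> neg_flag ` carrier G \<and> \<Psi> \<in> pos_flag ` carrier G"
proof -
  note unique = adjacent_flags_unique[OF abstract_polyhedron_coset_poset assms(2,1)]
  have "\<Phi> \<in> flags coset_poset" using assms(1) by (simp add: adjacent_flags_def)
  then consider x where "x \<in> carrier G" "\<Phi> = pos_flag x" | x where "x \<in> carrier G" "\<Phi> = neg_flag x"
    by (auto simp: flags_coset_poset)
  then show ?thesis
  proof cases
    case 1
    then have "\<Psi> = neg_flag (x \<otimes> adj_step i)"
      using unique adjacent_pos_neg[OF assms(2)] by simp
    then show ?thesis using 1 assms(2) by simp
  next
    case 2
    then have "\<Psi> = pos_flag (x \<otimes> inv (adj_step i))"
      using unique adjacent_neg_pos[OF assms(2)] by simp
    then show ?thesis using 2 assms(2) by simp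
  qed
qed

definition translation :: "'a \<Rightarrow> nat \<Rightarrow> nat" where
  "translation g n = (case prod_decode n of (i, m) \<Rightarrow>
    prod_encode (i, to_nat_on (Pow (carrier G)) (g <# from_nat_into (Pow (carrier G)) m)))"

lemma translation_node [simp]:
  assumes "g \<in> carrier G" "i \<le> 2" "x \<in> carrier G"
  shows "translation g (node i x) = node i (g \<otimes> x)"
proof -
  have sub: "stab i \<subseteq> carrier G" using subgroup.subset[OF subgroup_stab[OF assms(2)]] .
  then have "x <# stab i \<in> Pow (carrier G)" using l_coset_subset_G assms(3) by simp
  then have
    "from_nat_into (Pow (carrier G)) (to_nat_on (Pow (carrier G)) (x <# stab i)) = x <# stab i"
    using finite_carrier by (intro from_nat_into_to_nat_on countable_finite) simp_all
  then show ?thesis using lcos_m_assoc[OF sub assms(1,3)] by (simp add: translation_def node_def)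
qed

lemma automorphism_translation:
  assumes "g \<in> carrier G"
  shows "automorphism coset_poset (translation g)"
proof -
  have inverse: "translation (inv h) (translation h y) = y"
    if "h \<in> carrier G" "y \<in> elems coset_poset" for h y
    using that by (auto simp: elems_coset_poset m_assoc[symmetric])
  have closed: "translation h y \<in> elems coset_poset"
    if hy: "h \<in> carrier G" "y \<in> elems coset_poset" for h y
  proof -
    obtain i x where "y = node i x" "i \<le> 2" "x \<in> carrier G"
      using hy(2) by (auto simp: elems_coset_poset)
    then show ?thesis using hy(1) by simp
  qed
  have incident: "incident coset_poset (translation h y) (translation h z)"
    if "h \<in> carrier G" "incident coset_poset y z" for h y z
    using that unfolding incident_coset_poset_iff[of y] by auto
  have "bij_betw (translation g) (elems coset_poset) (elems coset_poset)"
    by (rule bij_betw_byWitness[where f' = "translation (inv g)"])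
      (use assms inverse[of g] inverse[of "inv g"] closed in auto)
  moreover have "rk coset_poset (translation g y) = rk coset_poset y"
    if "y \<in> elems coset_poset" for y
    using that assms by (auto simp: elems_coset_poset)
  moreover have
    "incident coset_poset (translation g y) (translation g z) \<longleftrightarrow> incident coset_poset y z"
    if "y \<in> elems coset_poset" "z \<in> elems coset_poset" for y z
    using incident[of "inv g" "translation g y" "translation g z"] incident[of g] inverse[of g]
      assms that by auto
  ultimately show ?thesis by (simp add: automorphism_def)
qed

lemma flag_image_translation:
  assumes "g \<in> carrier G" "x \<in> carrier G"
  shows "flag_image (translation g) (pos_flag x) = pos_flag (g \<otimes> x)"
    and "flag_image (translation g) (neg_flag x) = neg_flag (g \<otimes> x)"
  using assms by (simp_all add: flag_image_def pos_flag_def neg_flag_def m_assoc)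

lemma transitive_on_pos_flags: "transitive_on_flags coset_poset (pos_flag ` carrier G)"
  and transitive_on_neg_flags: "transitive_on_flags coset_poset (neg_flag ` carrier G)"
proof -
  have "\<exists>g\<in>carrier G. y = g \<otimes> x" if "x \<in> carrier G" "y \<in> carrier G" for x y
    using that by (intro bexI[of _ "y \<otimes> inv x"]) (simp_all add: m_assoc)
  then show "transitive_on_flags coset_poset (pos_flag ` carrier G)"
    "transitive_on_flags coset_poset (neg_flag ` carrier G)"
    unfolding transitive_on_flags_def ball_simps
    using automorphism_translation flag_image_translation by metis+
qed

lemma reversing_automorphism_adj_step:
  assumes aut: "automorphism coset_poset \<gamma>" and x: "x \<in> carrier G" and y: "y \<in> carrier G"
    and rev: "flag_image \<gamma> (pos_flag x) = neg_flag y" and i: "i \<le> 2"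
  shows "flag_image \<gamma> (pos_flag (x \<otimes> inv (adj_step i))) = neg_flag (y \<otimes> adj_step i)"
proof -
  note unique = adjacent_flags_unique[OF abstract_polyhedron_coset_poset]
  have "adjacent_flags coset_poset 1 (neg_flag y) (flag_image \<gamma> (neg_flag x))"
    using adjacent_flags_image[OF aut adjacent_pos_neg[of 1 x]] rev x by simp
  moreover have "adjacent_flags coset_poset 1 (neg_flag y) (pos_flag y)"
    using adjacent_neg_pos[of 1 y] y by simp
  ultimately have "flag_image \<gamma> (neg_flag x) = pos_flag y" using unique[of 1] by simp
  then have
    "adjacent_flags coset_poset i (pos_flag y) (flag_image \<gamma> (pos_flag (x \<otimes> inv (adj_step i))))"
    using adjacent_flags_image[OF aut adjacent_neg_pos[OF i x]] by simp
  then show ?thesis using adjacent_pos_neg[OF i y] unique[OF i] by blast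
qed

lemma reversing_automorphism_generate:
  assumes aut: "automorphism coset_poset \<gamma>" and x: "x \<in> carrier G" and y: "y \<in> carrier G"
    and rev: "flag_image \<gamma> (pos_flag x) = neg_flag y"
    and k: "k \<in> generate G {a} \<union> generate G {b}"
  shows "flag_image \<gamma> (pos_flag (x \<otimes> k)) = neg_flag (y \<otimes> inv k)"
proof -
  have "\<exists>i\<le>2. k \<in> generate G {inv (adj_step i)}"
    using k generate_inv[of a] unfolding le_2_iff
    by (metis UnE a_closed b_closed inv_inv adj_step_simps(1,3))
  then obtain i where i: "i \<le> 2" "k \<in> generate G {inv (adj_step i)}" by blast
  then obtain n :: nat where n: "k = inv (adj_step i) [^] n"
    using generate_pow_on_finite_carrier[OF finite_carrier, of "inv (adj_step i)"] by auto
  have "flag_image \<gamma> (pos_flag (x \<otimes> inv (adj_step i) [^] n)) = neg_flag (y \<otimes> adj_step i [^] n)"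
  proof (induction n)
    case 0
    then show ?case using rev x y by simp
  next
    case (Suc n)
    from reversing_automorphism_adj_step[OF aut _ _ this i(1)] show ?case
      using x y i(1) by (simp add: m_assoc)
  qed
  then show ?thesis using i(1) by (simp add: n nat_pow_inv)
qed

lemma reversing_automorphism_mult:
  assumes aut: "automorphism coset_poset \<gamma>" and x: "x \<in> carrier G" and y: "y \<in> carrier G"
    and rev: "flag_image \<gamma> (pos_flag x) = neg_flag y"
    and h: "h \<in> generate G {a}" and k: "k \<in> generate G {b}"
  shows "flag_image \<gamma> (pos_flag (x \<otimes> (h \<otimes> k))) = neg_flag (y \<otimes> (inv h \<otimes> inv k))"
proof -
  have closed: "h \<in> carrier G" "k \<in> carrier G"
    using h k generate_in_carrier[of "{a}"] generate_in_carrier[of "{b}"] by auto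
  have "flag_image \<gamma> (pos_flag (x \<otimes> h)) = neg_flag (y \<otimes> inv h)"
    using reversing_automorphism_generate[OF aut x y rev] h by simp
  then have "flag_image \<gamma> (pos_flag (x \<otimes> h \<otimes> k)) = neg_flag (y \<otimes> inv h \<otimes> inv k)"
    using reversing_automorphism_generate[OF aut] x y k closed by simp
  then show ?thesis using x y closed by (simp add: m_assoc)
qed

lemma reversing_automorphism_imp_reflexible:
  assumes aut: "automorphism coset_poset \<gamma>" and rev: "flag_image \<gamma> (pos_flag \<one>) = neg_flag \<one>"
  shows "reflexible G a b"
proof -
  have closed: "h \<in> carrier G" "k \<in> carrier G" if "h \<in> generate G {a}" "k \<in> generate G {b}" for h k
    using that generate_in_carrier[of "{a}"] generate_in_carrier[of "{b}"] by auto
  have image_one: "flag_image \<gamma> (pos_flag (h \<otimes> k)) = neg_flag (inv h \<otimes> inv k)"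
    if "h \<in> generate G {a}" "k \<in> generate G {b}" for h k
    using reversing_automorphism_mult[OF aut one_closed one_closed rev that] closed[OF that] by simp
  have "\<exists>y\<in>carrier G. flag_image \<gamma> (pos_flag x) = neg_flag y" if "x \<in> carrier G" for x
    using that image_one closed by (elim carrier_cases) (metis inv_closed m_closed)
  then obtain \<theta> where \<theta>: "\<And>x. x \<in> carrier G \<Longrightarrow> \<theta> x \<in> carrier G"
    "\<And>x. x \<in> carrier G \<Longrightarrow> flag_image \<gamma> (pos_flag x) = neg_flag (\<theta> x)" by metis
  have \<theta>_eqI: "\<theta> x = y"
    if "x \<in> carrier G" "y \<in> carrier G" "flag_image \<gamma> (pos_flag x) = neg_flag y" for x y
    using that \<theta> inj_onD[OF inj_on_neg_flag] by simp
  have \<theta>_factor: "\<theta> (h \<otimes> k) = inv h \<otimes> inv k" if "h \<in> generate G {a}" "k \<in> generate G {b}" for h k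
    using image_one[OF that] closed[OF that] by (intro \<theta>_eqI) simp_all
  have "\<theta> \<in> hom G G"
  proof (rule homI)
    fix x z assume x: "x \<in> carrier G" and "z \<in> carrier G"
    from \<open>z \<in> carrier G\<close> obtain h k
      where hk: "h \<in> generate G {a}" "k \<in> generate G {b}" "z = h \<otimes> k" by (rule carrier_cases)
    have "\<theta> (x \<otimes> (h \<otimes> k)) = \<theta> x \<otimes> (inv h \<otimes> inv k)"
      using reversing_automorphism_mult[OF aut x \<theta>(1,2)[OF x] hk(1,2)] x \<theta>(1) closed[OF hk(1,2)]
      by (intro \<theta>_eqI) simp_all
    then show "\<theta> (x \<otimes> z) = \<theta> x \<otimes> \<theta> z" using \<theta>_factor hk by simp
  qed (rule \<theta>)
  moreover have "\<theta> a = inv a" "\<theta> b = inv b"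
    using \<theta>_factor[of a \<one>] \<theta>_factor[of \<one> b] by (simp_all add: generate.one generate.incl)
  ultimately show ?thesis unfolding reflexible_def by blast
qed

theorem chiral_coset_poset:
  assumes "\<not> reflexible G a b"
  shows "chiral coset_poset"
proof -
  have "pos_flag \<one> \<in> flags coset_poset" "neg_flag \<one> \<in> flags coset_poset"
    by (auto simp: flags_coset_poset)
  then have "\<not> transitive_on_flags coset_poset (flags coset_poset)"
    unfolding transitive_on_flags_def
    using reversing_automorphism_imp_reflexible assms by blast
  then show ?thesis
    unfolding chiral_def
    using flags_coset_poset pos_neg_flags_disjoint adjacent_flags_alternate
      transitive_on_pos_flags transitive_on_neg_flags
    by (intro exI[of _ "pos_flag ` carrier G"] exI[of _ "neg_flag ` carrier G"]) simp
qed

lemma dual: "tight_rotation_group G (inv b) (inv a)"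
proof (intro tight_rotation_group.intro is_group tight_rotation_group_axioms.intro)
  have "inv b \<otimes> inv a = a \<otimes> b"
    using ab_involution inv_equality[of "a \<otimes> b" "a \<otimes> b"] by (simp add: inv_mult_group)
  then show "inv b \<otimes> inv a \<otimes> (inv b \<otimes> inv a) = \<one>" using ab_involution by simp
  show "generate G {inv b} \<inter> generate G {inv a} = {\<one>}"
    using trivial_intersection by (auto simp: generate_inv)
  have "carrier G \<subseteq> stab 0 <#> stab 2"
  proof
    fix g assume "g \<in> carrier G"
    then obtain h k where "h \<in> stab 0" "k \<in> stab 2" "g = h \<otimes> k"
      using stab_factorization[of 0 g] by auto
    then show "g \<in> stab 0 <#> stab 2" by (auto simp: set_mult_def)
  qed
  moreover have "stab 0 <#> stab 2 \<subseteq> carrier G"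
    by (intro set_mult_closed subgroup.subset[OF subgroup_stab]) simp_all
  ultimately show "carrier G = generate G {inv b} <#> generate G {inv a}"
    by (simp add: generate_inv stab_0 stab_2)
qed (use finite_carrier a_neq_one b_neq_one in auto)

lemma dual_reflexible: "reflexible G (inv b) (inv a) \<longleftrightarrow> reflexible G a b"
proof -
  have "\<theta> (inv c) = inv (inv c) \<longleftrightarrow> \<theta> c = inv c" if "\<theta> \<in> hom G G" "c \<in> carrier G" for \<theta> c
    using hom_inverting_generate[OF that(1), of c "inv c"]
      hom_inverting_generate[OF that(1), of "inv c" c] that(2)
    by (auto simp: generate_inv generate.incl generate.inv)
  then show ?thesis unfolding reflexible_def by blast
qed

theorem tight_chiral_type_rotation_group:
  assumes "\<not> reflexible G a b"
  shows "tight_chiral_type (card (generate G {a})) (card (generate G {b}))"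
    and "tight_chiral_type (card (generate G {b})) (card (generate G {a}))"
proof -
  show "tight_chiral_type (card (generate G {a})) (card (generate G {b}))"
    unfolding tight_chiral_type_def
    using abstract_polyhedron_coset_poset chiral_coset_poset[OF assms] tight_coset_poset by blast
  interpret dual: tight_rotation_group G "inv b" "inv a" by (rule dual)
  have "chiral dual.coset_poset"
    using dual.chiral_coset_poset assms by (simp add: dual_reflexible)
  then show "tight_chiral_type (card (generate G {b})) (card (generate G {a}))"
    unfolding tight_chiral_type_def
    using dual.abstract_polyhedron_coset_poset dual.tight_coset_poset
    unfolding generate_inv[OF a_closed] generate_inv[OF b_closed] by blast
qed

end

section \<open>Zappa--Szep products\<close>

locale matched_pair = H: group H + K: group K
  for H :: "('h, 'c) monoid_scheme" (structure) and K :: "('k, 'd) monoid_scheme" (structure) +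
  fixes lact :: "'k \<Rightarrow> 'h \<Rightarrow> 'h" and ract :: "'k \<Rightarrow> 'h \<Rightarrow> 'k"
  assumes lact_closed [simp]: "k \<in> carrier K \<Longrightarrow> h \<in> carrier H \<Longrightarrow> lact k h \<in> carrier H"
    and ract_closed [simp]: "k \<in> carrier K \<Longrightarrow> h \<in> carrier H \<Longrightarrow> ract k h \<in> carrier K"
    and lact_one [simp]: "h \<in> carrier H \<Longrightarrow> lact \<one>\<^bsub>K\<^esub> h = h"
    and ract_one [simp]: "k \<in> carrier K \<Longrightarrow> ract k \<one>\<^bsub>H\<^esub> = k"
    and lact_mult: "k \<in> carrier K \<Longrightarrow> k' \<in> carrier K \<Longrightarrow> h \<in> carrier H \<Longrightarrow>
      lact (k \<otimes>\<^bsub>K\<^esub> k') h = lact k (lact k' h)"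
    and ract_mult: "k \<in> carrier K \<Longrightarrow> h \<in> carrier H \<Longrightarrow> h' \<in> carrier H \<Longrightarrow>
      ract k (h \<otimes>\<^bsub>H\<^esub> h') = ract (ract k h) h'"
    and lact_distrib: "k \<in> carrier K \<Longrightarrow> h \<in> carrier H \<Longrightarrow> h' \<in> carrier H \<Longrightarrow>
      lact k (h \<otimes>\<^bsub>H\<^esub> h') = lact k h \<otimes>\<^bsub>H\<^esub> lact (ract k h) h'"
    and ract_distrib: "k \<in> carrier K \<Longrightarrow> k' \<in> carrier K \<Longrightarrow> h \<in> carrier H \<Longrightarrow>
      ract (k \<otimes>\<^bsub>K\<^esub> k') h = ract k (lact k' h) \<otimes>\<^bsub>K\<^esub> ract k' h"
begin

lemma lact_fixes_one [simp]: "k \<in> carrier K \<Longrightarrow> lact k \<one>\<^bsub>H\<^esub> = \<one>\<^bsub>H\<^esub>"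
  using lact_distrib[of k "\<one>\<^bsub>H\<^esub>" "\<one>\<^bsub>H\<^esub>"] by simp

lemma ract_fixes_one [simp]: "h \<in> carrier H \<Longrightarrow> ract \<one>\<^bsub>K\<^esub> h = \<one>\<^bsub>K\<^esub>"
  using ract_distrib[of "\<one>\<^bsub>K\<^esub>" "\<one>\<^bsub>K\<^esub>" h] by simp

definition zappa_szep :: "('h \<times> 'k) monoid" where
  "zappa_szep = \<lparr>carrier = carrier H \<times> carrier K,
    monoid.mult = (\<lambda>(h, k) (h', k'). (h \<otimes>\<^bsub>H\<^esub> lact k h', ract k h' \<otimes>\<^bsub>K\<^esub> k')),
    one = (\<one>\<^bsub>H\<^esub>, \<one>\<^bsub>K\<^esub>)\<rparr>"

lemma zappa_szep_simps [simp]: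
  "carrier zappa_szep = carrier H \<times> carrier K"
  "(h, k) \<otimes>\<^bsub>zappa_szep\<^esub> (h', k') = (h \<otimes>\<^bsub>H\<^esub> lact k h', ract k h' \<otimes>\<^bsub>K\<^esub> k')"
  "\<one>\<^bsub>zappa_szep\<^esub> = (\<one>\<^bsub>H\<^esub>, \<one>\<^bsub>K\<^esub>)"
  by (simp_all add: zappa_szep_def)

sublocale ZS: group zappa_szep
proof (rule groupI)
  fix x y z assume "x \<in> carrier zappa_szep" "y \<in> carrier zappa_szep" "z \<in> carrier zappa_szep"
  then show "x \<otimes>\<^bsub>zappa_szep\<^esub> y \<otimes>\<^bsub>zappa_szep\<^esub> z = x \<otimes>\<^bsub>zappa_szep\<^esub> (y \<otimes>\<^bsub>zappa_szep\<^esub> z)"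
    by (auto simp: lact_distrib ract_distrib lact_mult ract_mult H.m_assoc K.m_assoc)
next
  fix x assume "x \<in> carrier zappa_szep"
  then obtain h k where x: "x = (h, k)" "h \<in> carrier H" "k \<in> carrier K" by auto
  let ?k = "inv\<^bsub>K\<^esub> k" and ?h = "inv\<^bsub>H\<^esub> h"
  have "(lact ?k ?h, ract ?k ?h) \<otimes>\<^bsub>zappa_szep\<^esub> x = \<one>\<^bsub>zappa_szep\<^esub>"
    using x lact_distrib[of ?k ?h h, symmetric] ract_mult[of ?k ?h h, symmetric] by simp
  moreover have "(lact ?k ?h, ract ?k ?h) \<in> carrier zappa_szep" using x by simp
  ultimately show "\<exists>y\<in>carrier zappa_szep. y \<otimes>\<^bsub>zappa_szep\<^esub> x = \<one>\<^bsub>zappa_szep\<^esub>" by blast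
qed auto

lemma inl_hom: "group_hom H zappa_szep (\<lambda>h. (h, \<one>\<^bsub>K\<^esub>))"
  and inr_hom: "group_hom K zappa_szep (\<lambda>k. (\<one>\<^bsub>H\<^esub>, k))"
  by (auto intro!: group_hom.intro group_hom_axioms.intro homI)

lemma inv_inl: "h \<in> carrier H \<Longrightarrow> inv\<^bsub>zappa_szep\<^esub> (h, \<one>\<^bsub>K\<^esub>) = (inv\<^bsub>H\<^esub> h, \<one>\<^bsub>K\<^esub>)"
  and inv_inr: "k \<in> carrier K \<Longrightarrow> inv\<^bsub>zappa_szep\<^esub> (\<one>\<^bsub>H\<^esub>, k) = (\<one>\<^bsub>H\<^esub>, inv\<^bsub>K\<^esub> k)"
  using group_hom.hom_inv[OF inl_hom, of h] group_hom.hom_inv[OF inr_hom, of k] by simp_all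

lemma generate_inl:
    "x \<in> carrier H \<Longrightarrow> generate zappa_szep {(x, \<one>\<^bsub>K\<^esub>)} = generate H {x} \<times> {\<one>\<^bsub>K\<^esub>}"
  and generate_inr:
    "y \<in> carrier K \<Longrightarrow> generate zappa_szep {(\<one>\<^bsub>H\<^esub>, y)} = {\<one>\<^bsub>H\<^esub>} \<times> generate K {y}"
  using group_hom.generate_img[OF inl_hom, of "{x}"] group_hom.generate_img[OF inr_hom, of "{y}"]
  by auto

end

locale rotary_matched_pair = matched_pair H K lact ract
  for H :: "('h, 'c) monoid_scheme" (structure) and K :: "('k, 'd) monoid_scheme" (structure)
    and lact ract +
  fixes x :: 'h and y :: 'k
  assumes finite_H: "finite (carrier H)" and finite_K: "finite (carrier K)"
    and x_closed: "x \<in> carrier H" and y_closed: "y \<in> carrier K"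
    and x_generates: "generate H {x} = carrier H" and y_generates: "generate K {y} = carrier K"
    and x_neq_one: "x \<noteq> \<one>\<^bsub>H\<^esub>" and y_neq_one: "y \<noteq> \<one>\<^bsub>K\<^esub>"
    and lact_y_x: "lact y x = inv\<^bsub>H\<^esub> x" and ract_y_x: "ract y x = inv\<^bsub>K\<^esub> y"
begin

sublocale tight_rotation_group zappa_szep "(x, \<one>\<^bsub>K\<^esub>)" "(\<one>\<^bsub>H\<^esub>, y)"
proof
  let ?A = "generate zappa_szep {(x, \<one>\<^bsub>K\<^esub>)}" and ?B = "generate zappa_szep {(\<one>\<^bsub>H\<^esub>, y)}"
  have generates: "?A = carrier H \<times> {\<one>\<^bsub>K\<^esub>}" "?B = {\<one>\<^bsub>H\<^esub>} \<times> carrier K"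
    using x_closed y_closed by (simp_all add: generate_inl generate_inr x_generates y_generates)
  then show "?A \<inter> ?B = {\<one>\<^bsub>zappa_szep\<^esub>}" by auto
  show "carrier zappa_szep = ?A <#>\<^bsub>zappa_szep\<^esub> ?B" unfolding generates by (auto simp: set_mult_def)
qed (use finite_H finite_K x_closed y_closed x_neq_one y_neq_one in \<open>auto simp: lact_y_x ract_y_x\<close>)

lemma card_generate_inl: "card (generate zappa_szep {(x, \<one>\<^bsub>K\<^esub>)}) = card (carrier H)"
  and card_generate_inr: "card (generate zappa_szep {(\<one>\<^bsub>H\<^esub>, y)}) = card (carrier K)"
  using x_closed y_closed
  by (simp_all add: generate_inl generate_inr x_generates y_generates card_cartesian_product)

lemma reflexible_imp_ract_inv:
  assumes "reflexible zappa_szep (x, \<one>\<^bsub>K\<^esub>) (\<one>\<^bsub>H\<^esub>, y)" "h \<in> carrier H" "k \<in> carrier K"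
  shows "ract (inv\<^bsub>K\<^esub> k) (inv\<^bsub>H\<^esub> h) = inv\<^bsub>K\<^esub> (ract k h)"
proof -
  obtain \<theta> where \<theta>: "\<theta> \<in> hom zappa_szep zappa_szep"
    "\<theta> (x, \<one>\<^bsub>K\<^esub>) = inv\<^bsub>zappa_szep\<^esub> (x, \<one>\<^bsub>K\<^esub>)" "\<theta> (\<one>\<^bsub>H\<^esub>, y) = inv\<^bsub>zappa_szep\<^esub> (\<one>\<^bsub>H\<^esub>, y)"
    using assms(1) by (auto simp: reflexible_def)
  have \<theta>_inl: "\<theta> (h, \<one>\<^bsub>K\<^esub>) = (inv\<^bsub>H\<^esub> h, \<one>\<^bsub>K\<^esub>)" if "h \<in> carrier H" for h
    using ZS.hom_inverting_generate[OF \<theta>(1) _ \<theta>(2), of "(h, \<one>\<^bsub>K\<^esub>)"] that x_closed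
    by (simp add: generate_inl x_generates inv_inl)
  have \<theta>_inr: "\<theta> (\<one>\<^bsub>H\<^esub>, k) = (\<one>\<^bsub>H\<^esub>, inv\<^bsub>K\<^esub> k)" if "k \<in> carrier K" for k
    using ZS.hom_inverting_generate[OF \<theta>(1) _ \<theta>(3), of "(\<one>\<^bsub>H\<^esub>, k)"] that y_closed
    by (simp add: generate_inr y_generates inv_inr)
  note \<theta>_mult = hom_mult[OF \<theta>(1)]
  have "\<theta> (lact k h, ract k h) = (inv\<^bsub>H\<^esub> (lact k h), inv\<^bsub>K\<^esub> (ract k h))"
    using \<theta>_mult[of "(lact k h, \<one>\<^bsub>K\<^esub>)" "(\<one>\<^bsub>H\<^esub>, ract k h)"] assms(2,3) by (simp add: \<theta>_inl \<theta>_inr)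
  moreover have "\<theta> (lact k h, ract k h)
      = (lact (inv\<^bsub>K\<^esub> k) (inv\<^bsub>H\<^esub> h), ract (inv\<^bsub>K\<^esub> k) (inv\<^bsub>H\<^esub> h))"
    using \<theta>_mult[of "(\<one>\<^bsub>H\<^esub>, k)" "(h, \<one>\<^bsub>K\<^esub>)"] assms(2,3) by (simp add: \<theta>_inl \<theta>_inr)
  ultimately show ?thesis by simp
qed

end

section \<open>A two-sided cocycle modulo \<open>32 s\<close>\<close>

text \<open>The \<open>\<delta>\<close> of the introduction: up to the factor \<open>\<int>/R\<close> of \<open>\<langle>a\<rangle>\<close>, the groups satisfy
  \<open>b\<^sup>f a\<^sup>u = a\<^bsup>u + \<delta>\<^esup> b\<^bsup>f + \<delta>\<^esup>\<close> for \<open>\<delta> = twist s f u\<close>.\<close>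

definition twist :: "int \<Rightarrow> int \<Rightarrow> int \<Rightarrow> int" where
  "twist s f u = (if even u then 4 * s * f * u else - 2 * f - 4 * s * f * (u - f))"

lemma cong_diffI: "a - b = m * k \<Longrightarrow> [a = b] (mod m)" for a b m k :: int
  by (simp add: cong_iff_dvd_diff)

lemma even_twist [simp]: "even (twist s f u)"
  by (auto simp: twist_def)

lemma twist_zero [simp]: "twist s 0 u = 0" "twist s f 0 = 0"
  by (simp_all add: twist_def)

lemma twist_cong:
  assumes "[f = g] (mod 32 * s)" "[u = v] (mod 8)"
  shows "[twist s f u = twist s g v] (mod 32 * s)"
proof -
  obtain k where k: "u = v + 8 * k" using assms(2) by (metis add.commute cong_iff_lin cong_sym)
  obtain l where l: "f = g + 32 * s * l" using assms(1) by (metis add.commute cong_iff_lin cong_sym)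
  show ?thesis
  proof (cases "even u")
    case True
    then have "twist s f u - twist s g v = 32 * s * (4 * s * l * u + g * k)"
      by (simp add: twist_def k l algebra_simps)
    then show ?thesis by (rule cong_diffI)
  next
    case False
    then have "twist s f u - twist s g v
        = 32 * s * (4 * s * f * l - 2 * l - 4 * s * l * (u - g) - g * k)"
      by (simp add: twist_def k l algebra_simps)
    then show ?thesis by (rule cong_diffI)
  qed
qed

lemma odd_mult_diff_cases:
  fixes u f :: int
  assumes "odd u"
  obtains t where "f * (u - f) = 2 * t"
proof -
  have "even (f * (u - f))" using assms by auto
  then show thesis using that by (elim evenE)
qed

lemma twist_add_left:
  "[twist s (f + g) u = twist s f (u + twist s g u) + twist s g u] (mod 32 * s)"
proof (cases "even u")
  case True
  then obtain b where b: "u = 2 * b" by (elim evenE)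
  have "twist s (f + g) u - (twist s f (u + twist s g u) + twist s g u)
      = 32 * s * (- s * f * g * b)"
    by (simp add: twist_def b algebra_simps)
  then show ?thesis by (rule cong_diffI)
next
  case False
  then obtain t where t: "g * (u - g) = 2 * t" by (rule odd_mult_diff_cases)
  have "twist s (f + g) u - (twist s f (u + twist s g u) + twist s g u)
      = - 16 * s * s * f * (g * (u - g))"
    using False by (simp add: twist_def algebra_simps)
  also have "\<dots> = 32 * s * (- s * f * t)" unfolding t by simp
  finally show ?thesis by (rule cong_diffI)
qed

lemma twist_add_right_even:
  assumes "even u"
  shows "[twist s f (u + v) = twist s f u + twist s (f + twist s f u) v] (mod 32 * s)"
proof -
  obtain a where a: "u = 2 * a" using assms by (elim evenE)
  show ?thesis
  proof (cases "even v")
    case True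
    then obtain b where b: "v = 2 * b" by (elim evenE)
    have "twist s f (u + v) - (twist s f u + twist s (f + twist s f u) v)
        = 32 * s * (- 2 * s * a * b * f)"
      by (simp add: twist_def a b algebra_simps)
    then show ?thesis by (rule cong_diffI)
  next
    case False
    then have "twist s f (u + v) - (twist s f u + twist s (f + twist s f u) v)
        = 32 * s * (s * a * f * (v - 2 * f - 4 * s * u * f))"
      by (simp add: twist_def a algebra_simps)
    then show ?thesis by (rule cong_diffI)
  qed
qed

lemma twist_add_right_odd:
  assumes "odd u"
  shows "[twist s f (u + v) = twist s f u + twist s (f + twist s f u) v] (mod 32 * s)"
proof -
  obtain t where t: "f * (u - f) = 2 * t" using odd_mult_diff_cases[OF assms] .
  then have twist_u: "twist s f u = - 2 * f - 8 * s * t"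
    using assms by (simp add: twist_def mult.assoc)
  show ?thesis
  proof (cases "even v")
    case True
    then have "twist s f (u + v) - (twist s f u + twist s (f + twist s f u) v)
        = 4 * s * (2 * t - f * (u - f)) + 32 * s * (s * t * v)"
      using assms unfolding twist_u by (simp add: twist_def algebra_simps)
    also have "\<dots> = 32 * s * (s * t * v)" using t by simp
    finally show ?thesis by (rule cong_diffI)
  next
    case False
    then have "twist s f (u + v) - (twist s f u + twist s (f + twist s f u) v)
        = 4 * s * (f * (u - f) - 2 * t) + 32 * s * (- s * t * (v + 2 * f + 8 * s * t))"
      using assms unfolding twist_u by (simp add: twist_def algebra_simps)
    also have "\<dots> = 32 * s * (- s * t * (v + 2 * f + 8 * s * t))" using t by simp
    finally show ?thesis by (rule cong_diffI)
  qed
qed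

lemma twist_add_right:
  "[twist s f (u + v) = twist s f u + twist s (f + twist s f u) v] (mod 32 * s)"
  by (cases "even u") (simp_all add: twist_add_right_even twist_add_right_odd)

lemma twist_not_odd:
  assumes "s > 0"
  shows "\<not> [twist s (- 2) (- 1) = - twist s 2 1] (mod 32 * s)"
proof -
  have "twist s (- 2) (- 1) + twist s 2 1 = 16 * s" by (simp add: twist_def)
  moreover have "\<not> 32 * s dvd 16 * s" using assms zdvd_imp_le[of "32 * s" "16 * s"] by auto
  ultimately show ?thesis by (simp add: cong_iff_dvd_diff)
qed

section \<open>Tight chiral polyhedra of type \<open>{8 r, 32 s}\<close>\<close>

lemma generate_integer_mod_group:
  "generate (integer_mod_group n) {1 mod int n} = carrier (integer_mod_group n)"
  (is "generate ?G {?x} = _")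
proof
  interpret group ?G by simp
  have x: "?x \<in> carrier ?G" by (simp add: carrier_integer_mod_group)
  then show "generate ?G {?x} \<subseteq> carrier ?G" by (intro generate_incl) simp
  show "carrier ?G \<subseteq> generate ?G {?x}"
  proof
    fix z assume "z \<in> carrier ?G"
    then have "?x [^]\<^bsub>?G\<^esub> z = z"
      by (auto simp: int_pow_integer_mod_group carrier_integer_mod_group mod_mult_right_eq
          split: if_splits)
    then show "z \<in> generate ?G {?x}"
      unfolding generate_pow[OF x] by (intro CollectI exI[of _ z]) simp
  qed
qed

lemma generate_integer_mod_group_DirProd:
  assumes "coprime m n"
  shows "generate (integer_mod_group m \<times>\<times> integer_mod_group n) {(1 mod int m, 1 mod int n)}
    = carrier (integer_mod_group m \<times>\<times> integer_mod_group n)" (is "generate ?G {?x} = _")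
proof
  interpret group ?G by (intro DirProd_group group_integer_mod_group)
  have x: "?x \<in> carrier ?G" by (auto simp: carrier_integer_mod_group zmod_trivial_iff)
  then show "generate ?G {?x} \<subseteq> carrier ?G" by (intro generate_incl) simp
  show "carrier ?G \<subseteq> generate ?G {?x}"
  proof
    fix z assume z: "z \<in> carrier ?G"
    obtain k where k: "[k = fst z] (mod int m)" "[k = snd z] (mod int n)"
      using binary_chinese_remainder_int[of "int m" "int n"] assms by auto
    have fst: "fst \<in> hom ?G (integer_mod_group m)" and snd: "snd \<in> hom ?G (integer_mod_group n)"
      by (auto intro: homI simp: mult_DirProd')
    have "?x [^]\<^bsub>?G\<^esub> k = (k mod int m, k mod int n)"
      using hom_int_pow[OF fst x is_group] hom_int_pow[OF snd x is_group]
      by (simp add: int_pow_integer_mod_group mod_mult_right_eq prod_eq_iff)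
    also have "\<dots> = z"
      using z k by (cases z) (auto simp: carrier_integer_mod_group cong_def split: if_splits)
    finally show "z \<in> generate ?G {?x}" using generate_pow[OF x] by blast
  qed
qed

locale twisted_pair =
  fixes M R s :: nat
  assumes eight_dvd_M: "8 dvd M" and M_dvd: "M dvd 32 * s"
    and R_pos: "R > 0" and s_pos: "s > 0" and coprime_M_R: "coprime M R"
begin

abbreviation "q \<equiv> 32 * int s"
abbreviation "H \<equiv> integer_mod_group M \<times>\<times> integer_mod_group R"
abbreviation "K \<equiv> integer_mod_group (32 * s)"

definition lact :: "int \<Rightarrow> int \<times> int \<Rightarrow> int \<times> int" where
  "lact f = map_prod (\<lambda>u. (u + twist s f u) mod M) (\<lambda>w. (if even f then w else - w) mod R)"

definition ract :: "int \<Rightarrow> int \<times> int \<Rightarrow> int" where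
  "ract f h = (f + twist s f (fst h)) mod q"

lemma M_pos: "M > 0"
  using M_dvd s_pos by (intro gr0I) simp

lemma carrier_H: "carrier H = {0..<int M} \<times> {0..<int R}" and carrier_K: "carrier K = {0..<q}"
  using M_pos R_pos s_pos by (simp_all add: carrier_integer_mod_group)

lemma cong_mod_M: "[u = v] (mod q) \<Longrightarrow> [u = v] (mod int M)"
  using M_dvd by (metis cong_dvd_modulus int_dvd_int_iff of_nat_mult of_nat_numeral)

lemma twist_cong_mod:
  assumes "[f = g] (mod q)" "[u = v] (mod int M)"
  shows "[twist s f u = twist s g v] (mod q)"
proof (rule twist_cong[OF assms(1)])
  have "8 dvd int M" using eight_dvd_M by presburger
  then show "[u = v] (mod 8)" using assms(2) cong_dvd_modulus by blast
qed

lemma twist_add_left_mod: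
  "[twist s ((f + g) mod q) u = twist s f ((u + twist s g u) mod int M) + twist s g u] (mod q)"
proof -
  have "[twist s ((f + g) mod q) u = twist s (f + g) u] (mod q)"
    by (intro twist_cong_mod) (simp_all add: cong_def)
  also have "[twist s (f + g) u = twist s f (u + twist s g u) + twist s g u] (mod q)"
    by (rule twist_add_left)
  also have "[twist s f (u + twist s g u) + twist s g u
      = twist s f ((u + twist s g u) mod int M) + twist s g u] (mod q)"
    by (intro cong_add twist_cong_mod) (simp_all add: cong_def)
  finally show ?thesis .
qed

lemma twist_add_right_mod:
  "[twist s f ((u + v) mod int M) = twist s f u + twist s ((f + twist s f u) mod q) v] (mod q)"
proof -
  have "[twist s f ((u + v) mod int M) = twist s f (u + v)] (mod q)"
    by (intro twist_cong_mod) (simp_all add: cong_def)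
  also have "[twist s f (u + v) = twist s f u + twist s (f + twist s f u) v] (mod q)"
    by (rule twist_add_right)
  also have "[twist s f u + twist s (f + twist s f u) v
      = twist s f u + twist s ((f + twist s f u) mod q) v] (mod q)"
    by (intro cong_add twist_cong_mod) (simp_all add: cong_def)
  finally show ?thesis .
qed

lemma even_mod_q [simp]: "even (f mod q) \<longleftrightarrow> even f"
  by (simp add: dvd_mod_iff)

lemma lact_ract_add_left:
  "lact (f \<otimes>\<^bsub>K\<^esub> g) h = lact f (lact g h)"
  "ract (f \<otimes>\<^bsub>K\<^esub> g) h = ract f (lact g h) \<otimes>\<^bsub>K\<^esub> ract g h"
proof -
  obtain u w where h: "h = (u, w)" by (metis surj_pair)
  note twist_eq = twist_add_left_mod[of f g u]
  have "[u + twist s ((f + g) mod q) u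
      = u + (twist s f ((u + twist s g u) mod int M) + twist s g u)] (mod int M)"
    by (rule cong_add[OF cong_refl cong_mod_M[OF twist_eq]])
  then show "lact (f \<otimes>\<^bsub>K\<^esub> g) h = lact f (lact g h)"
    by (simp add: lact_def h cong_def mod_simps add_ac)
  have "[f + g + twist s ((f + g) mod q) u
      = f + g + (twist s f ((u + twist s g u) mod int M) + twist s g u)] (mod q)"
    by (rule cong_add[OF cong_refl twist_eq])
  then show "ract (f \<otimes>\<^bsub>K\<^esub> g) h = ract f (lact g h) \<otimes>\<^bsub>K\<^esub> ract g h"
    by (simp add: ract_def lact_def h cong_def mod_simps) (simp add: add_ac)
qed

lemma lact_ract_add_right:
  "ract f (h \<otimes>\<^bsub>H\<^esub> h') = ract (ract f h) h'"
  "lact f (h \<otimes>\<^bsub>H\<^esub> h') = lact f h \<otimes>\<^bsub>H\<^esub> lact (ract f h) h'"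
proof -
  obtain u w v w' where h: "h = (u, w)" "h' = (v, w')" by (metis surj_pair)
  note twist_eq = twist_add_right_mod[of f u v]
  have "[f + twist s f ((u + v) mod int M)
      = f + (twist s f u + twist s ((f + twist s f u) mod q) v)] (mod q)"
    by (rule cong_add[OF cong_refl twist_eq])
  then show "ract f (h \<otimes>\<^bsub>H\<^esub> h') = ract (ract f h) h'"
    by (simp add: ract_def h cong_def mod_simps add_ac)
  have "[u + v + twist s f ((u + v) mod int M)
      = u + v + (twist s f u + twist s ((f + twist s f u) mod q) v)] (mod int M)"
    by (rule cong_add[OF cong_refl cong_mod_M[OF twist_eq]])
  then show "lact f (h \<otimes>\<^bsub>H\<^esub> h') = lact f h \<otimes>\<^bsub>H\<^esub> lact (ract f h) h'"
    by (simp add: lact_def ract_def h cong_def mod_simps) (simp add: add_ac)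
qed

sublocale matched_pair H K lact ract
proof (intro matched_pair.intro matched_pair_axioms.intro DirProd_group group_integer_mod_group)
  show "lact f h \<in> carrier H" "ract f h \<in> carrier K" for f h
    unfolding carrier_H carrier_K using M_pos R_pos s_pos
    by (simp_all add: lact_def ract_def map_prod_def split_beta)
  show "lact \<one>\<^bsub>K\<^esub> h = h" if "h \<in> carrier H" for h
    using that unfolding carrier_H by (auto simp: lact_def)
  show "ract f \<one>\<^bsub>H\<^esub> = f" if "f \<in> carrier K" for f
    using that unfolding carrier_K by (auto simp: ract_def)
qed (rule lact_ract_add_left lact_ract_add_right)+

lemma one_mod_M [simp]: "1 mod int M = 1"
  using dvd_imp_le[OF eight_dvd_M M_pos] by simp

abbreviation "gen_H \<equiv> (1, 1 mod int R)"

lemma gen_H_closed: "gen_H \<in> carrier H"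
  unfolding carrier_H using M_pos R_pos one_mod_M pos_mod_bound[of "int M" 1] by simp

lemma inv_gen_H: "inv\<^bsub>H\<^esub> gen_H = ((- 1) mod int M, (- 1) mod int R)"
  using gen_H_closed by (simp add: mod_minus_eq)

sublocale rotary_matched_pair H K lact ract gen_H 1
proof
  show "finite (carrier H)" "finite (carrier K)"
    unfolding carrier_H carrier_K by auto
  show "gen_H \<in> carrier H" by (rule gen_H_closed)
  show "1 \<in> carrier K" unfolding carrier_K using s_pos by auto
  show "generate H {gen_H} = carrier H"
    using generate_integer_mod_group_DirProd[OF coprime_M_R] by simp
  show "generate K {1} = carrier K"
    using generate_integer_mod_group[of "32 * s"] s_pos by simp
  show "gen_H \<noteq> \<one>\<^bsub>H\<^esub>" "1 \<noteq> \<one>\<^bsub>K\<^esub>" by simp_all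
  have "twist s 1 1 = - 2" by (simp add: twist_def)
  then show "lact 1 gen_H = inv\<^bsub>H\<^esub> gen_H" "ract 1 gen_H = inv\<^bsub>K\<^esub> 1"
    using s_pos by (simp_all add: inv_gen_H lact_def ract_def mod_minus_eq carrier_K)
qed

lemma not_reflexible: "\<not> reflexible zappa_szep (gen_H, \<one>\<^bsub>K\<^esub>) (\<one>\<^bsub>H\<^esub>, 1)"
proof
  assume "reflexible zappa_szep (gen_H, \<one>\<^bsub>K\<^esub>) (\<one>\<^bsub>H\<^esub>, 1)"
  moreover have closed: "2 \<in> carrier K" unfolding carrier_K using s_pos by auto
  ultimately have "ract (inv\<^bsub>K\<^esub> 2) (inv\<^bsub>H\<^esub> gen_H) = inv\<^bsub>K\<^esub> (ract 2 gen_H)"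
    using reflexible_imp_ract_inv gen_H_closed by blast
  then have "[- 2 + twist s ((- 2) mod q) ((- 1) mod int M) = - (2 + twist s 2 1)] (mod q)"
    using closed ract_closed[OF closed gen_H_closed]
    by (simp add: inv_gen_H ract_def cong_def mod_add_left_eq mod_minus_eq)
  then have "[twist s ((- 2) mod q) ((- 1) mod int M) = - twist s 2 1] (mod q)"
    by (simp add: cong_iff_dvd_diff)
  moreover have "[twist s ((- 2) mod q) ((- 1) mod int M) = twist s (- 2) (- 1)] (mod q)"
    by (intro twist_cong_mod) (simp_all add: cong_def)
  ultimately have "[twist s (- 2) (- 1) = - twist s 2 1] (mod q)"
    by (rule cong_trans[OF cong_sym, rotated])
  then show False using twist_not_odd[of "int s"] s_pos by simp
qed

end

lemma (in twisted_pair) tight_chiral_type_twisted_pair: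
  "tight_chiral_type (M * R) (32 * s)" "tight_chiral_type (32 * s) (M * R)"
proof -
  have "card (carrier H) = M * R" "card (carrier K) = 32 * s"
    unfolding carrier_H carrier_K by (simp_all add: card_cartesian_product)
  then show "tight_chiral_type (M * R) (32 * s)" "tight_chiral_type (32 * s) (M * R)"
    using tight_chiral_type_rotation_group[OF not_reflexible]
    unfolding card_generate_inl card_generate_inr by simp_all
qed

lemma tight_chiral_type_of_2_parts:
  fixes i j m n :: nat
  assumes "3 \<le> i" "i \<le> j" "5 \<le> j" "odd m" "n > 0"
  shows "tight_chiral_type (2 ^ i * m) (2 ^ j * n)" and "tight_chiral_type (2 ^ j * n) (2 ^ i * m)"
proof -
  have j: "32 * (2 ^ (j - 5) * n) = 2 ^ j * n"
    using power_add[of "2 :: nat" 5 "j - 5"] assms(3) by simp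
  interpret twisted_pair "2 ^ i" m "2 ^ (j - 5) * n"
  proof
    show "8 dvd (2 :: nat) ^ i" using le_imp_power_dvd[OF assms(1), of "2 :: nat"] by simp
    show "2 ^ i dvd 32 * (2 ^ (j - 5) * n)"
      unfolding j by (intro dvd_mult2 le_imp_power_dvd assms(2))
  qed (use assms(4,5) in \<open>auto intro: odd_pos\<close>)
  show "tight_chiral_type (2 ^ i * m) (2 ^ j * n)" "tight_chiral_type (2 ^ j * n) (2 ^ i * m)"
    using tight_chiral_type_twisted_pair unfolding j by simp_all
qed

lemma power2_odd_decomposition:
  assumes "n > (0 :: nat)"
  obtains k m where "n = 2 ^ k * m" "odd m"
proof -
  obtain m where "n = 2 ^ multiplicity 2 n * m" "odd m"
    using multiplicity_decompose'[of n 2] assms by auto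
  then show thesis by (rule that)
qed

theorem theorem3p14:
  fixes r s :: nat
  assumes "r > 0" and "s > 0"
  shows "\<exists>P :: nat ranked_poset. abstract_polyhedron P \<and> chiral P \<and> tight_of_type P (8 * r) (32 * s)"
proof -
  obtain k m where r: "r = 2 ^ k * m" "odd m" using power2_odd_decomposition[OF assms(1)] .
  obtain l n where s: "s = 2 ^ l * n" "odd n" using power2_odd_decomposition[OF assms(2)] .
  have type: "8 * r = 2 ^ (k + 3) * m" "32 * s = 2 ^ (l + 5) * n" by (simp_all add: r s power_add)
  have pos: "m > 0" "n > 0" using r(2) s(2) by (auto intro: odd_pos)
  have "tight_chiral_type (8 * r) (32 * s)"
  proof (cases "k + 3 \<le> l + 5")
    case True
    then show ?thesis
      unfolding type using r(2) pos by (intro tight_chiral_type_of_2_parts(1)) simp_all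
  next
    case False
    then show ?thesis
      unfolding type using s(2) pos by (intro tight_chiral_type_of_2_parts(2)) simp_all
  qed
  then show ?thesis unfolding tight_chiral_type_def .
qed

end
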